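(* Let $g,\ell\geq 1$ be integers. For every integer $h$ with $1\leq h\leq g+\ell$, the pair $(g\mathsf{exc}_{\ell},g\mathsf{den}_{h})$ is $(g+\ell-1)$-Euler--Mahonian; that is, for every positive integer $n$, $$\sum_{\sigma\in\mathfrak{S}_n} t^{g\mathsf{exc}_\ell(\sigma)}q^{g\mathsf{den}_h(\sigma)}=\sum_{\sigma\in\mathfrak{S}_n} t^{(g+\ell-1)\mathsf{des}(\sigma)}q^{(g+\ell-1)\mathsf{maj}(\sigma)}.$$
   Context: $\mathfrak{S}_n$ is the set of permutations of $[n]$, written $\sigma=\sigma_1\cdots\sigma_n$. For a word $u$ of distinct integers, $\mathsf{inv}(u)$ is the number of pairs of positions $i<j$ with $u_i>u_j$. $g\mathsf{exc}_\ell(\sigma)=|\{i\in[n]:\sigma_i\geq i+g,\ i\geq\ell\}|$. $g\mathsf{Exclp}_h(\sigma)=\{i\in[n]:\sigma_i\geq i+g,\ \sigma_i\geq h\}$. Let $g\mathrm{EXCL}_h(\sigma)$ be the subsequence of $\sigma$ consisting of the letters $\sigma_i$ with $i\in g\mathsf{Exclp}_h(\sigma)$ and $g\mathrm{NEXCL}_h(\sigma)$ the subsequence of the remaining letters. Then $g\mathsf{den}_h(\sigma)=\sum_{i\in g\mathsf{Exclp}_h(\sigma)}(i+g-1)+\mathsf{inv}(g\mathrm{EXCL}_h(\sigma))+\mathsf{inv}(g\mathrm{NEXCL}_h(\sigma))$. For an integer $r\ge1$: $r\mathsf{des}(\sigma)=|\{i\in[n-1]:\sigma_i\geq\sigma_{i+1}+r\}|$,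 and $r\mathsf{maj}(\sigma)=\sum_{i\in[n-1],\,\sigma_i\geq\sigma_{i+1}+r} i+|\{(i,j):i<j,\ \sigma_i>\sigma_j,\ \sigma_i<\sigma_j+r\}|$. A pair of permutation statistics is $r$-Euler--Mahonian if for every $n\geq1$ its joint distribution over $\mathfrak{S}_n$ equals that of $(r\mathsf{des},r\mathsf{maj})$. *)

theory Defs
  imports Main "HOL-Combinatorics.Permutations"
begin

text \<open>
  The elements of the symmetric group on \<open>{1..n}\<close> are the functions \<open>\<sigma>\<close> with
  \<open>\<sigma> permutes {1..n}\<close>; the letter in position \<open>i\<close> is \<open>\<sigma> i\<close>, with positions counted
  from 1. Such a \<open>\<sigma>\<close> does not determine \<open>n\<close>, hence every statistic takes \<open>n\<close> as an
  argument.
\<close>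

definition sym_grp :: "nat \<Rightarrow> (nat \<Rightarrow> nat) set" where
  "sym_grp n = {\<sigma>. \<sigma> permutes {1..n}}"

definition inv_word :: "nat list \<Rightarrow> nat" where
  "inv_word u = card {(i, j). i < j \<and> j < length u \<and> u ! i > u ! j}"

definition exc :: "nat \<Rightarrow> nat \<Rightarrow> nat \<Rightarrow> (nat \<Rightarrow> nat) \<Rightarrow> nat" where
  "exc g l n \<sigma> = card {i \<in> {1..n}. \<sigma> i \<ge> i + g \<and> i \<ge> l}"

definition Exclp :: "nat \<Rightarrow> nat \<Rightarrow> nat \<Rightarrow> (nat \<Rightarrow> nat) \<Rightarrow> nat set" where
  "Exclp g h n \<sigma> = {i \<in> {1..n}. \<sigma> i \<ge> i + g \<and> \<sigma> i \<ge> h}"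

definition EXCL :: "nat \<Rightarrow> nat \<Rightarrow> nat \<Rightarrow> (nat \<Rightarrow> nat) \<Rightarrow> nat list" where
  "EXCL g h n \<sigma> = map \<sigma> (filter (\<lambda>i. i \<in> Exclp g h n \<sigma>) [1..<n+1])"

definition NEXCL :: "nat \<Rightarrow> nat \<Rightarrow> nat \<Rightarrow> (nat \<Rightarrow> nat) \<Rightarrow> nat list" where
  "NEXCL g h n \<sigma> = map \<sigma> (filter (\<lambda>i. i \<notin> Exclp g h n \<sigma>) [1..<n+1])"

text \<open>The subtraction below is never truncated, since positions satisfy \<open>i \<ge> 1\<close>.\<close>

definition den :: "nat \<Rightarrow> nat \<Rightarrow> nat \<Rightarrow> (nat \<Rightarrow> nat) \<Rightarrow> nat" where
  "den g h n \<sigma> = (\<Sum>i\<in>Exclp g h n \<sigma>. i + g - 1)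
     + inv_word (EXCL g h n \<sigma>) + inv_word (NEXCL g h n \<sigma>)"

definition rDes :: "nat \<Rightarrow> nat \<Rightarrow> (nat \<Rightarrow> nat) \<Rightarrow> nat set" where
  "rDes r n \<sigma> = {i \<in> {1..<n}. \<sigma> i \<ge> \<sigma> (i + 1) + r}"

definition rdes :: "nat \<Rightarrow> nat \<Rightarrow> (nat \<Rightarrow> nat) \<Rightarrow> nat" where
  "rdes r n \<sigma> = card (rDes r n \<sigma>)"

definition rmaj :: "nat \<Rightarrow> nat \<Rightarrow> (nat \<Rightarrow> nat) \<Rightarrow> nat" where
  "rmaj r n \<sigma> = (\<Sum>i\<in>rDes r n \<sigma>. i)
     + card {(i, j). i \<in> {1..n} \<and> j \<in> {1..n} \<and> i < j \<and> \<sigma> i > \<sigma> j \<and> \<sigma> i < \<sigma> j + r}"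

definition Euler_Mahonian ::
    "nat \<Rightarrow> (nat \<Rightarrow> (nat \<Rightarrow> nat) \<Rightarrow> nat) \<Rightarrow> (nat \<Rightarrow> (nat \<Rightarrow> nat) \<Rightarrow> nat) \<Rightarrow> bool" where
  "Euler_Mahonian r stat1 stat2 \<longleftrightarrow>
     (\<forall>n\<ge>1. \<forall>a b. card {\<sigma> \<in> sym_grp n. stat1 n \<sigma> = a \<and> stat2 n \<sigma> = b}
                = card {\<sigma> \<in> sym_grp n. rdes r n \<sigma> = a \<and> rmaj r n \<sigma> = b})"

end

theory Submission
  imports Defs "HOL-Computational_Algebra.Polynomial"
begin

text \<open>
  Both pairs obey one recursion in \<^term>\<open>n\<close>: a permutation of \<open>{1..n}\<close> with statistics \<open>(k, m)\<close>
  produces \<open>n + 1\<close> permutations of \<open>{1..n+1}\<close>, with second statistics \<open>m, m + 1, \<dots>, m + n\<close>,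
  where the first \<open>k + r\<close> of them keep \<open>k\<close> and the others have \<open>k + 1\<close>; here \<open>r = g + l - 1\<close>.
  For \<open>(rdes, rmaj)\<close> this is insertion of the largest letter.

  For \<open>(exc, den)\<close> permutations are grouped by the set \<open>E\<close> of positions and the set \<open>F\<close> of
  values of the excedances. Filling the positions greedily shows that the inversions inside such a
  class are counted by a product of \<open>q\<close>-integers. When \<open>n + 1\<close> is an excedance value, the
  product of the class is a telescoping sum over the classes obtained by replacing \<open>n + 1\<close> by a
  smaller value, or by deleting it together with an excedance position. Read backwards, these are
  exactly the moves required by the recursion.
\<close>

section \<open>Permutations of finite sets counted by inversions\<close>

text \<open>The number r = g + l - 1 has two sources. A largest letter n + 1 that is no excedance
  value can stand in \<open>g\<close> positions, which gives the increments 0, ..., g - 1. And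
  \<open>exc\<close> overlooks only the excedance positions below \<open>l\<close>, so a class with
  k counted excedances has at most k + (l - 1) excedances in all. The bound on \<open>h\<close>
  makes an excedance at a position \<ge> \<open>l\<close> reach \<open>h\<close> automatically, so
  \<open>exc\<close> can be read off from E. On the excedance side the moves are not carried out on
  single permutations; the recursion is an identity between class sums. Since a move may change the
  first statistic, that statistic carries an arbitrary weight \<open>w\<close>, and the recursion
  pulls \<open>w\<close> back from size n + 1 to size n. Induction over all \<open>w\<close> then
  compares both pairs without a formula for either distribution. The product formula must also be
  right for classes that contain no permutation. Slot counts are therefore integers that may be
  negative, and several side conditions of the telescoping sum exist only to make such degenerate
  products vanish.\<close>

definition qbr :: "'a::comm_semiring_1 \<Rightarrow> nat \<Rightarrow> 'a" where
  "qbr q m = (\<Sum>j<m. q ^ j)"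

lemma qbr_0 [simp]: "qbr q 0 = 0"
  by (simp add: qbr_def)

lemma qbr_Suc: "qbr q (Suc m) = qbr q m + q ^ m"
  by (simp add: qbr_def)

lemma qbr_Suc': "qbr q (Suc m) = 1 + q * qbr q m"
  unfolding qbr_def by (subst sum.lessThan_Suc_shift) (simp add: sum_distrib_left)

section \<open>Rank sums over finite sets of naturals\<close>

lemma sum_rank_below:
  fixes A :: "nat set" and \<phi> :: "nat \<Rightarrow> 'b::comm_monoid_add"
  assumes "finite A"
  shows "(\<Sum>p\<in>A. \<phi> (card {a\<in>A. a < p})) = (\<Sum>c<card A. \<phi> c)"
  using assms
proof (induction A rule: finite_linorder_max_induct)
  case (insert b A)
  have "{a \<in> insert b A. a < p} = {a\<in>A. a < p}" if "p \<in> A" for p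
    using insert.hyps(2) that by auto
  moreover have "{a \<in> insert b A. a < b} = A"
    using insert.hyps(2) by auto
  moreover have "b \<notin> A"
    using insert.hyps(2) by auto
  ultimately show ?case
    using insert by (simp add: add.commute)
qed simp

lemma sum_rank_above:
  fixes A :: "nat set" and \<phi> :: "nat \<Rightarrow> 'b::comm_monoid_add"
  assumes "finite A"
  shows "(\<Sum>p\<in>A. \<phi> (card {a\<in>A. p < a})) = (\<Sum>c<card A. \<phi> c)"
  using assms
proof (induction A rule: finite_linorder_min_induct)
  case (insert b A)
  have "{a \<in> insert b A. p < a} = {a\<in>A. p < a}" if "p \<in> A" for p
    using insert.hyps(2) that by auto
  moreover have "{a \<in> insert b A. b < a} = A"
    using insert.hyps(2) by auto
  moreover have "b \<notin> A"
    using insert.hyps(2) by auto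
  ultimately show ?case
    using insert by (simp add: add.commute)
qed simp

lemma card_filter_split:
  assumes "finite A" shows "card {x\<in>A. P x} + card {x\<in>A. \<not> P x} = card A"
proof -
  have "A \<inter> Collect P = {x\<in>A. P x}" "A - Collect P = {x\<in>A. \<not> P x}" by auto
  then show ?thesis
    using card_Int_Diff[OF assms, of "Collect P"] by simp
qed

text \<open>Exactly p numbers lie below p, some in \<open>A\<close> and some not. Adding the
  elements of \<open>A\<close> above p completes the former to all of \<open>A\<close>, so what
  remains is the rank of p in the complement.\<close>

lemma card_above_complement:
  fixes A :: "nat set"
  assumes "A \<subseteq> {..<n}" "p < n" "p \<notin> A"
  shows "p + card {a\<in>A. p < a} = card A + card {x\<in>{..<n} - A. x < p}"
proof -
  have fin: "finite A" using assms(1) finite_subset by blast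
  have "card {x\<in>{..<p}. x \<in> A} + card {x\<in>{..<p}. x \<notin> A} = p"
    using card_filter_split[of "{..<p}" "\<lambda>x. x \<in> A"] by simp
  moreover have "{x\<in>{..<p}. x \<in> A} = {a\<in>A. \<not> p < a}"
    using assms(3) by (auto simp: not_less le_less)
  moreover have "{x\<in>{..<p}. x \<notin> A} = {x\<in>{..<n} - A. x < p}"
    using assms(2) by auto
  moreover have "card {a\<in>A. p < a} + card {a\<in>A. \<not> p < a} = card A"
    using card_filter_split[OF fin] by simp
  ultimately show ?thesis by simp
qed

text \<open>Counterpart of \<open>sum_rank_above\<close>: the elements of \<open>A\<close> receive
  the values 0, ..., card A - 1 and the places outside \<open>A\<close> the values from card A to n
  - 1, each once. Both recursions distribute their increments in this way.\<close>

lemma sum_corank_above: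
  fixes A :: "nat set" and \<phi> :: "nat \<Rightarrow> 'b::comm_monoid_add"
  assumes "A \<subseteq> {..<n}"
  shows "(\<Sum>p\<in>{..<n} - A. \<phi> (p + card {a\<in>A. p < a})) = (\<Sum>c\<in>{card A..<n}. \<phi> c)"
proof -
  have fin: "finite A" using assms finite_subset by blast
  have "(\<Sum>p\<in>{..<n} - A. \<phi> (p + card {a\<in>A. p < a}))
      = (\<Sum>p\<in>{..<n} - A. \<phi> (card A + card {x\<in>{..<n} - A. x < p}))"
    using card_above_complement[OF assms] by (intro sum.cong) auto
  also have "\<dots> = (\<Sum>c<card ({..<n} - A). \<phi> (card A + c))"
    by (rule sum_rank_below[where \<phi> = "\<lambda>c. \<phi> (card A + c)"]) simp
  also have "\<dots> = (\<Sum>c\<in>{card A..<n}. \<phi> c)"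
    using assms fin
    by (intro sum.reindex_bij_witness[of _ "\<lambda>c. c - card A" "\<lambda>c. card A + c"])
       (auto simp: card_Diff_subset)
  finally show ?thesis .
qed

section \<open>Inversion generating functions of bijections with bounds\<close>

definition bijs :: "nat set \<Rightarrow> nat set \<Rightarrow> (nat \<Rightarrow> nat) set" where
  "bijs A B = {s \<in> extensional A. bij_betw s A B}"

definition invs :: "nat set \<Rightarrow> (nat \<Rightarrow> nat) \<Rightarrow> nat" where
  "invs A s = card {(i, j). i \<in> A \<and> j \<in> A \<and> i < j \<and> s j < s i}"

lemma invs_cong: "(\<And>i. i \<in> A \<Longrightarrow> s i = s' i) \<Longrightarrow> invs A s = invs A s'"
  unfolding invs_def by (rule arg_cong[where f = card]) auto

lemma finite_bijs:
  assumes "finite A" "finite B"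
  shows "finite (bijs A B)"
proof (rule finite_subset)
  show "bijs A B \<subseteq> A \<rightarrow>\<^sub>E B"
    by (auto simp: bijs_def PiE_def bij_betw_def)
qed (use assms in \<open>simp add: finite_PiE\<close>)

lemma bijs_empty: "bijs {} {} = {\<lambda>_. undefined}"
  by (auto simp: bijs_def bij_betw_def)

lemma sum_bijs_insert:
  assumes "finite A" "finite B" "x \<notin> A"
  shows "(\<Sum>s\<in>bijs (insert x A) B. F s)
       = (\<Sum>v\<in>B. \<Sum>s\<in>bijs A (B - {v}). F (s(x := v)))"
proof -
  have "(\<Sum>s\<in>bijs (insert x A) B. F s)
      = (\<Sum>(v, s)\<in>(SIGMA v:B. bijs A (B - {v})). F (s(x := v)))"
  proof (rule sum.reindex_bij_witness
      [of _ "\<lambda>(v, s). s(x := v)" "\<lambda>s. (s x, restrict s A)"])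
    fix s assume s: "s \<in> bijs (insert x A) B"
    then have b: "bij_betw s (insert x A) B" and e: "s \<in> extensional (insert x A)"
      by (auto simp: bijs_def)
    have "(restrict s A)(x := s x) = s"
      using e assms(3) by (auto simp: extensional_def restrict_def)
    then show "(case (s x, restrict s A) of (v, s) \<Rightarrow> s(x := v)) = s"
      and "(case (s x, restrict s A) of (v, s) \<Rightarrow> F (s(x := v))) = F s" by auto
    have "bij_betw s A (B - {s x})"
      using b assms(3) unfolding bij_betw_def by (auto dest: sym)
    then have "bij_betw (restrict s A) A (B - {s x})"
      by (simp cong: bij_betw_cong)
    then show "(s x, restrict s A) \<in> (SIGMA v:B. bijs A (B - {v}))"
      using b by (auto simp: bijs_def bij_betw_def)
  next
    fix vs assume "vs \<in> (SIGMA v:B. bijs A (B - {v}))"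
    then obtain v s where vs: "vs = (v, s)" "v \<in> B" and b: "bij_betw s A (B - {v})"
      and e: "s \<in> extensional A" by (auto simp: bijs_def)
    have eq: "(s(x := v)) i = s i" if "i \<in> A" for i using that assms(3) by auto
    have "bij_betw (s(x := v)) A (B - {v})"
      using b by (subst bij_betw_cong[of A "s(x := v)" s, OF eq]) simp_all
    then have "bij_betw (s(x := v)) (insert x A) B"
      using vs(2) assms(3) by (auto simp: bij_betw_def)
    then show "(case vs of (v, s) \<Rightarrow> s(x := v)) \<in> bijs (insert x A) B"
      using vs(1) e by (auto simp: bijs_def extensional_def)
    show "((case vs of (v, s) \<Rightarrow> s(x := v)) x,
        restrict (case vs of (v, s) \<Rightarrow> s(x := v)) A) = vs"
      using vs(1) e assms(3) by (auto simp: extensional_def restrict_def)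
  qed
  also have "\<dots> = (\<Sum>v\<in>B. \<Sum>s\<in>bijs A (B - {v}). F (s(x := v)))"
    using assms by (subst sum.Sigma) (auto intro: finite_bijs)
  finally show ?thesis .
qed

lemma invs_insert:
  assumes "finite A" "x \<notin> A"
  shows "invs (insert x A) s
    = invs A s + card {i\<in>A. i < x \<and> s x < s i} + card {j\<in>A. x < j \<and> s j < s x}"
proof -
  let ?I = "{(i, j). i \<in> A \<and> j \<in> A \<and> i < j \<and> s j < s i}"
  let ?L = "{i\<in>A. i < x \<and> s x < s i}" and ?R = "{j\<in>A. x < j \<and> s j < s x}"
  have fin: "finite ?I" by (rule finite_subset[of _ "A \<times> A"]) (use assms in auto)
  have "{(i, j). i \<in> insert x A \<and> j \<in> insert x A \<and> i < j \<and> s j < s i}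
      = (?I \<union> (\<lambda>i. (i, x)) ` ?L) \<union> (\<lambda>j. (x, j)) ` ?R"
    by auto
  moreover have "card ((?I \<union> (\<lambda>i. (i, x)) ` ?L) \<union> (\<lambda>j. (x, j)) ` ?R)
      = card (?I \<union> (\<lambda>i. (i, x)) ` ?L) + card ((\<lambda>j. (x, j)) ` ?R)"
    by (rule card_Un_disjoint) (use assms fin in auto)
  moreover have "card (?I \<union> (\<lambda>i. (i, x)) ` ?L) = card ?I + card ((\<lambda>i. (i, x)) ` ?L)"
    by (rule card_Un_disjoint) (use assms fin in auto)
  moreover have "card ((\<lambda>i. (i, x)) ` ?L) = card ?L" "card ((\<lambda>j. (x, j)) ` ?R) = card ?R"
    by (rule card_image; simp add: inj_on_def)+
  ultimately show ?thesis by (simp add: invs_def)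
qed

lemma card_bij_betw_filter:
  assumes "bij_betw s A B"
  shows "card {i\<in>A. P (s i)} = card {v\<in>B. P v}"
proof -
  have "s ` {i\<in>A. P (s i)} = {v\<in>B. P v}" "inj_on s {i\<in>A. P (s i)}"
    using assms by (auto simp: bij_betw_def inj_on_def)
  then show ?thesis by (metis card_image)
qed

text \<open>Positions are filled from left to right. A value \<open>v\<close> at the leftmost
  position causes one inversion for each smaller value, which sums to a q-integer. Since the bounds
  \<open>a\<close> increase, \<open>v\<close> also lies below every later bound, so each later
  position loses exactly one choice. If the choices run out, the truncated difference is 0 and kills
  the product, in accordance with the absence of admissible bijections.\<close>

lemma sum_bijs_below:
  fixes q :: "'a::comm_semiring_1"
  assumes "finite A" "finite B" "card A = card B"
    and "\<And>i j. i \<in> A \<Longrightarrow> j \<in> A \<Longrightarrow> i \<le> j \<Longrightarrow> a i \<le> a j"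
  shows "(\<Sum>s\<in>bijs A B. if \<forall>i\<in>A. s i < a i then q ^ invs A s else 0)
       = (\<Prod>i\<in>A. qbr q (card {v\<in>B. v < a i} - card {j\<in>A. j < i}))"
  using assms
proof (induction A arbitrary: B rule: finite_linorder_min_induct)
  case empty
  then show ?case by (simp add: bijs_empty invs_def)
next
  case (insert x A)
  have x: "x \<notin> A" "\<And>i. i \<in> A \<Longrightarrow> x < i" "\<And>i. i \<in> A \<Longrightarrow> \<not> i < x"
    using insert.hyps(2) by (auto dest: order.asym)
  let ?F = "\<lambda>A s. if \<forall>i\<in>A. s i < a i then q ^ invs A s else 0"
  let ?P = "\<Prod>i\<in>A. qbr q (card {v\<in>B. v < a i} - card {j\<in>insert x A. j < i})"
  have step: "(\<Sum>s\<in>bijs A (B - {v}). ?F (insert x A) (s(x := v)))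
      = (if v < a x then q ^ card {u\<in>B. u < v} * ?P else 0)" if v: "v \<in> B" for v
  proof (cases "v < a x")
    case False
    then show ?thesis by simp
  next
    case True
    have "?F (insert x A) (s(x := v)) = q ^ card {u\<in>B. u < v} * ?F A s"
      if s: "s \<in> bijs A (B - {v})" for s
    proof -
      have "card {j\<in>A. s j < v} = card {u\<in>B - {v}. u < v}"
        using s by (intro card_bij_betw_filter) (simp add: bijs_def)
      moreover have "{u\<in>B - {v}. u < v} = {u\<in>B. u < v}" by auto
      moreover have "invs A (s(x := v)) = invs A s"
        using x by (intro invs_cong) auto
      moreover have "{j\<in>A. x < j \<and> (s(x := v)) j < v} = {j\<in>A. s j < v}"
        using x by auto
      moreover have "{i\<in>A. i < x \<and> v < (s(x := v)) i} = {}"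
        using x by auto
      ultimately have "invs (insert x A) (s(x := v)) = card {u\<in>B. u < v} + invs A s"
        using x insert.hyps(1) by (simp add: invs_insert)
      moreover have "(\<forall>i\<in>insert x A. (s(x := v)) i < a i) \<longleftrightarrow> (\<forall>i\<in>A. s i < a i)"
        using True x by auto
      ultimately show ?thesis by (simp add: power_add)
    qed
    then have "(\<Sum>s\<in>bijs A (B - {v}). ?F (insert x A) (s(x := v)))
        = q ^ card {u\<in>B. u < v} * (\<Sum>s\<in>bijs A (B - {v}). ?F A s)"
      by (simp add: sum_distrib_left)
    also have "(\<Sum>s\<in>bijs A (B - {v}). ?F A s)
        = (\<Prod>i\<in>A. qbr q (card {u\<in>B - {v}. u < a i} - card {j\<in>A. j < i}))"
      using insert.prems insert.hyps(1) x v by (intro insert.IH) auto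
    also have "\<dots> = ?P"
    proof (intro prod.cong refl arg_cong[where f = "qbr q"])
      fix i assume i: "i \<in> A"
      have "v < a i"
        using True insert.prems(3)[of x i] i x(2)[OF i] by auto
      then have "{u\<in>B. u < a i} = insert v {u\<in>B - {v}. u < a i}" using v by auto
      then have "card {u\<in>B. u < a i} = Suc (card {u\<in>B - {v}. u < a i})"
        using insert.prems(1) by simp
      moreover have "{j\<in>insert x A. j < i} = insert x {j\<in>A. j < i}"
        using x i by auto
      then have "card {j\<in>insert x A. j < i} = Suc (card {j\<in>A. j < i})"
        using insert.hyps(1) x by simp
      ultimately show "card {u\<in>B - {v}. u < a i} - card {j\<in>A. j < i}
          = card {v\<in>B. v < a i} - card {j\<in>insert x A. j < i}" by simp
    qed
    finally show ?thesis using True by simp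
  qed
  have "(\<Sum>s\<in>bijs (insert x A) B. ?F (insert x A) s)
      = (\<Sum>v\<in>B. if v < a x then q ^ card {u\<in>B. u < v} * ?P else 0)"
    unfolding sum_bijs_insert[OF insert.hyps(1) insert.prems(1) x(1)]
    by (intro sum.cong refl step)
  \<comment> \<open>Values below an admissible \<open>v\<close> are admissible too, so the exponent
    is the rank of \<open>v\<close> among the admissible values.\<close>
  also have "\<dots> = (\<Sum>v\<in>{v\<in>B. v < a x}. q ^ card {u\<in>{v\<in>B. v < a x}. u < v}) * ?P"
    using insert.prems(1)
    by (auto simp: sum_distrib_right sum.inter_filter[symmetric]
        intro!: sum.cong arg_cong[where f = "\<lambda>S. q ^ card S * _"])
  also have "\<dots> = qbr q (card {v\<in>B. v < a x}) * ?P"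
    using insert.prems(1)
    by (subst sum_rank_below[where \<phi> = "\<lambda>c. q ^ c"]) (simp_all add: qbr_def)
  also have "\<dots> = (\<Prod>i\<in>insert x A. qbr q (card {v\<in>B. v < a i} - card {j\<in>insert x A. j < i}))"
  proof -
    have "{j\<in>insert x A. j < x} = {}" using x by auto
    then show ?thesis
      unfolding prod.insert[OF insert.hyps(1) x(1)] by (simp only: card.empty diff_zero)
  qed
  finally show ?case .
qed

text \<open>Mirror image of the previous filling: it starts at the rightmost position, where the
  lower bound is largest. The value chosen there is admissible for every position further left and
  costs one inversion per larger value.\<close>

lemma sum_bijs_above:
  fixes q :: "'a::comm_semiring_1"
  assumes "finite A" "finite B" "card A = card B"
    and "\<And>i j. i \<in> A \<Longrightarrow> j \<in> A \<Longrightarrow> i \<le> j \<Longrightarrow> a i \<le> a j"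
  shows "(\<Sum>s\<in>bijs A B. if \<forall>i\<in>A. a i \<le> s i then q ^ invs A s else 0)
       = (\<Prod>i\<in>A. qbr q (card {v\<in>B. a i \<le> v} - card {j\<in>A. i < j}))"
  using assms
proof (induction A arbitrary: B rule: finite_linorder_max_induct)
  case empty
  then show ?case by (simp add: bijs_empty invs_def)
next
  case (insert x A)
  have x: "x \<notin> A" "\<And>i. i \<in> A \<Longrightarrow> i < x" "\<And>i. i \<in> A \<Longrightarrow> \<not> x < i"
    using insert.hyps(2) by (auto dest: order.asym)
  let ?F = "\<lambda>A s. if \<forall>i\<in>A. a i \<le> s i then q ^ invs A s else 0"
  let ?P = "\<Prod>i\<in>A. qbr q (card {v\<in>B. a i \<le> v} - card {j\<in>insert x A. i < j})"
  have step: "(\<Sum>s\<in>bijs A (B - {v}). ?F (insert x A) (s(x := v)))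
      = (if a x \<le> v then q ^ card {u\<in>B. v < u} * ?P else 0)" if v: "v \<in> B" for v
  proof (cases "a x \<le> v")
    case False
    then show ?thesis by simp
  next
    case True
    have "?F (insert x A) (s(x := v)) = q ^ card {u\<in>B. v < u} * ?F A s"
      if s: "s \<in> bijs A (B - {v})" for s
    proof -
      have "card {j\<in>A. v < s j} = card {u\<in>B - {v}. v < u}"
        using s by (intro card_bij_betw_filter) (simp add: bijs_def)
      moreover have "{u\<in>B - {v}. v < u} = {u\<in>B. v < u}" by auto
      moreover have "invs A (s(x := v)) = invs A s"
        using x by (intro invs_cong) auto
      moreover have "{j\<in>A. j < x \<and> v < (s(x := v)) j} = {j\<in>A. v < s j}"
        using x by auto
      moreover have "{i\<in>A. x < i \<and> (s(x := v)) i < v} = {}"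
        using x by auto
      ultimately have "invs (insert x A) (s(x := v)) = card {u\<in>B. v < u} + invs A s"
        using x insert.hyps(1) by (simp add: invs_insert)
      moreover have "(\<forall>i\<in>insert x A. a i \<le> (s(x := v)) i) \<longleftrightarrow> (\<forall>i\<in>A. a i \<le> s i)"
        using True x by auto
      ultimately show ?thesis by (simp add: power_add)
    qed
    then have "(\<Sum>s\<in>bijs A (B - {v}). ?F (insert x A) (s(x := v)))
        = q ^ card {u\<in>B. v < u} * (\<Sum>s\<in>bijs A (B - {v}). ?F A s)"
      by (simp add: sum_distrib_left)
    also have "(\<Sum>s\<in>bijs A (B - {v}). ?F A s)
        = (\<Prod>i\<in>A. qbr q (card {u\<in>B - {v}. a i \<le> u} - card {j\<in>A. i < j}))"
      using insert.prems insert.hyps(1) x v by (intro insert.IH) auto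
    also have "\<dots> = ?P"
    proof (intro prod.cong refl arg_cong[where f = "qbr q"])
      fix i assume i: "i \<in> A"
      have "a i \<le> v"
        using True insert.prems(3)[of i x] i x(2)[OF i] by auto
      then have "{u\<in>B. a i \<le> u} = insert v {u\<in>B - {v}. a i \<le> u}" using v by auto
      then have "card {u\<in>B. a i \<le> u} = Suc (card {u\<in>B - {v}. a i \<le> u})"
        using insert.prems(1) by simp
      moreover have "{j\<in>insert x A. i < j} = insert x {j\<in>A. i < j}"
        using x i by auto
      then have "card {j\<in>insert x A. i < j} = Suc (card {j\<in>A. i < j})"
        using insert.hyps(1) x by simp
      ultimately show "card {u\<in>B - {v}. a i \<le> u} - card {j\<in>A. i < j}
          = card {v\<in>B. a i \<le> v} - card {j\<in>insert x A. i < j}" by simp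
    qed
    finally show ?thesis using True by simp
  qed
  have "(\<Sum>s\<in>bijs (insert x A) B. ?F (insert x A) s)
      = (\<Sum>v\<in>B. if a x \<le> v then q ^ card {u\<in>B. v < u} * ?P else 0)"
    unfolding sum_bijs_insert[OF insert.hyps(1) insert.prems(1) x(1)]
    by (intro sum.cong refl step)
  also have "\<dots> = (\<Sum>v\<in>{v\<in>B. a x \<le> v}. q ^ card {u\<in>{v\<in>B. a x \<le> v}. v < u}) * ?P"
    using insert.prems(1)
    by (auto simp: sum_distrib_right sum.inter_filter[symmetric]
        intro!: sum.cong arg_cong[where f = "\<lambda>S. q ^ card S * _"])
  also have "\<dots> = qbr q (card {v\<in>B. a x \<le> v}) * ?P"
    using insert.prems(1)
    by (subst sum_rank_above[where \<phi> = "\<lambda>c. q ^ c"]) (simp_all add: qbr_def)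
  also have "\<dots> = (\<Prod>i\<in>insert x A. qbr q (card {v\<in>B. a i \<le> v} - card {j\<in>insert x A. i < j}))"
  proof -
    have "{j\<in>insert x A. x < j} = {}" using x by auto
    then show ?thesis
      unfolding prod.insert[OF insert.hyps(1) x(1)] by (simp only: card.empty diff_zero)
  qed
  finally show ?case .
qed

section \<open>Inserting the largest letter\<close>

text \<open>\<open>p\<close> is the number of letters in front of the new one, so the gaps are 0,
  ..., n.\<close>

definition insert_max :: "nat \<Rightarrow> nat \<Rightarrow> (nat \<Rightarrow> nat) \<Rightarrow> nat \<Rightarrow> nat" where
  "insert_max n p \<tau> i =
    (if i \<le> p then \<tau> i else if i = Suc p then Suc n else if i \<le> Suc n then \<tau> (i - 1) else i)"

lemma sym_grp_le: "\<tau> \<in> sym_grp n \<Longrightarrow> i \<le> n \<Longrightarrow> \<tau> i \<le> n"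
  by (cases "i = 0") (auto simp: sym_grp_def permutes_not_in dest: permutes_in_image[of _ _ i])

lemma sym_grp_pos: "\<tau> \<in> sym_grp n \<Longrightarrow> 1 \<le> i \<Longrightarrow> 1 \<le> \<tau> i"
  by (cases "i \<le> n") (auto simp: sym_grp_def permutes_not_in dest: permutes_in_image[of _ _ i])

lemma sym_grp_above: "\<tau> \<in> sym_grp n \<Longrightarrow> n < i \<Longrightarrow> \<tau> i = i"
  by (auto simp: sym_grp_def permutes_not_in)

lemma sym_grp_eq_iff: "\<tau> \<in> sym_grp n \<Longrightarrow> \<tau> i = \<tau> j \<longleftrightarrow> i = j"
  by (auto simp: sym_grp_def dest: permutes_inj injD)

lemma finite_sym_grp: "finite (sym_grp n)"
  by (simp add: sym_grp_def finite_permutations)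

lemma insert_max_in_sym_grp:
  assumes "\<tau> \<in> sym_grp n" "p \<le> n"
  shows "insert_max n p \<tau> \<in> sym_grp (Suc n)"
proof -
  let ?\<sigma> = "insert_max n p \<tau>"
  have "?\<sigma> i \<in> {1..Suc n}" if "i \<in> {1..Suc n}" for i
    using that assms(2) sym_grp_pos[OF assms(1), of i] sym_grp_pos[OF assms(1), of "i - 1"]
      sym_grp_le[OF assms(1), of i] sym_grp_le[OF assms(1), of "i - 1"]
    by (auto simp: insert_max_def intro: le_SucI)
  then have "?\<sigma> ` {1..Suc n} \<subseteq> {1..Suc n}" by blast
  moreover have "inj_on ?\<sigma> {1..Suc n}"
  proof (rule inj_onI)
    fix i j assume ij: "i \<in> {1..Suc n}" "j \<in> {1..Suc n}" "?\<sigma> i = ?\<sigma> j"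
    have "?\<sigma> k \<le> n" if "k \<in> {1..Suc n}" "k \<noteq> Suc p" for k
      using that assms(2) sym_grp_le[OF assms(1), of k] sym_grp_le[OF assms(1), of "k - 1"]
      by (auto simp: insert_max_def)
    moreover have "?\<sigma> (Suc p) = Suc n" by (simp add: insert_max_def)
    ultimately have "i = Suc p \<longleftrightarrow> j = Suc p"
      using ij by (metis Suc_n_not_le_n)
    then show "i = j"
      using ij by (auto simp: insert_max_def sym_grp_eq_iff[OF assms(1)] split: if_splits)
  qed
  ultimately have "bij_betw ?\<sigma> {1..Suc n} {1..Suc n}"
    by (simp add: bij_betw_def endo_inj_surj)
  moreover have "?\<sigma> i = i" if "i \<notin> {1..Suc n}" for i
  proof -
    have "\<tau> 0 = 0" using assms(1) by (auto simp: sym_grp_def permutes_not_in)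
    then show ?thesis
      using that assms(2) by (cases "i = 0") (auto simp: insert_max_def)
  qed
  ultimately show ?thesis
    unfolding sym_grp_def by (auto intro: bij_imp_permutes)
qed

lemma insert_max_inject:
  assumes "\<tau> \<in> sym_grp n" "p \<le> n" "\<tau>' \<in> sym_grp n" "p' \<le> n"
    and eq: "insert_max n p \<tau> = insert_max n p' \<tau>'"
  shows "p = p' \<and> \<tau> = \<tau>'"
proof -
  have less: "\<not> p < p'" if "insert_max n p \<tau> = insert_max n p' \<tau>'"
    "\<tau>' \<in> sym_grp n" "p' \<le> n" for p p' \<tau> \<tau>'
  proof
    assume "p < p'"
    then have "Suc n = \<tau>' (Suc p)"
      using fun_cong[OF that(1), of "Suc p"] by (simp add: insert_max_def)
    with \<open>p < p'\<close> show False
      using that(3) sym_grp_le[OF that(2), of "Suc p"] by simp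
  qed
  have p: "p = p'"
    using less[OF eq assms(3,4)] less[OF eq[symmetric] assms(1,2)] by simp
  have "\<tau> i = \<tau>' i" for i
  proof (cases "i \<le> p \<or> n < i")
    case True
    then show ?thesis
      using fun_cong[OF eq, of i] p sym_grp_above[OF assms(1), of i] sym_grp_above[OF assms(3), of i]
      by (auto simp: insert_max_def split: if_splits)
  next
    case False
    then show ?thesis
      using fun_cong[OF eq, of "Suc i"] p by (auto simp: insert_max_def)
  qed
  with p show ?thesis by auto
qed

text \<open>Only injectivity of the insertion is proved directly; surjectivity follows from (n + 1)
  * n! = (n + 1)!.\<close>

lemma sum_sym_grp_Suc:
  "(\<Sum>\<sigma>\<in>sym_grp (Suc n). F \<sigma>) = (\<Sum>\<tau>\<in>sym_grp n. \<Sum>p<Suc n. F (insert_max n p \<tau>))"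
proof -
  let ?S = "sym_grp n \<times> {..<Suc n}" and ?f = "\<lambda>(\<tau>, p). insert_max n p \<tau>"
  have inj: "inj_on ?f ?S"
    using insert_max_inject by (fastforce simp: inj_on_def less_Suc_eq_le)
  have sub: "?f ` ?S \<subseteq> sym_grp (Suc n)"
    using insert_max_in_sym_grp by auto
  have card: "card (sym_grp m) = fact m" for m
    unfolding sym_grp_def by (rule card_permutations) auto
  have "card (?f ` ?S) = card (sym_grp (Suc n))"
    using card_image[OF inj] by (simp add: card card_cartesian_product)
  then have "?f ` ?S = sym_grp (Suc n)"
    using sub by (intro card_subset_eq finite_sym_grp)
  then have "(\<Sum>\<sigma>\<in>sym_grp (Suc n). F \<sigma>) = (\<Sum>x\<in>?S. F (?f x))"
    using sum.reindex[OF inj, of F] by simp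
  also have "\<dots> = (\<Sum>\<tau>\<in>sym_grp n. \<Sum>p<Suc n. F (insert_max n p \<tau>))"
    unfolding sum.cartesian_product by (simp only: case_prod_unfold)
  finally show ?thesis .
qed

section \<open>Effect of the insertion on descents and on close inversions\<close>

definition small_inv :: "nat \<Rightarrow> nat \<Rightarrow> (nat \<Rightarrow> nat) \<Rightarrow> (nat \<times> nat) set" where
  "small_inv r n \<sigma> = {(i, j). i \<in> {1..n} \<and> j \<in> {1..n} \<and> i < j \<and> \<sigma> i > \<sigma> j \<and> \<sigma> i < \<sigma> j + r}"

text \<open>The gaps of \<^term>\<open>\<tau>\<close> in which inserting the letter \<^term>\<open>Suc n\<close> creates no new descent.\<close>

definition neutral_gaps :: "nat \<Rightarrow> nat \<Rightarrow> (nat \<Rightarrow> nat) \<Rightarrow> nat set" where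
  "neutral_gaps r n \<tau> = {p. p \<le> n \<and> (p < n \<longrightarrow> \<tau> (Suc p) + r \<le> Suc n \<longrightarrow> p \<in> rDes r n \<tau>)}"

text \<open>A descent at \<open>p\<close> is destroyed, because the maximum now follows; a descent
  at p + 1, just behind the maximum, may take its place. All other descents keep their two
  letters.\<close>

lemma rDes_insert_max:
  assumes "\<tau> \<in> sym_grp n" "p \<le> n" "1 \<le> r"
  shows "rDes r (Suc n) (insert_max n p \<tau>) =
    {i \<in> rDes r n \<tau>. i < p} \<union> Suc ` {i \<in> rDes r n \<tau>. p < i}
      \<union> (if p < n \<and> \<tau> (Suc p) + r \<le> Suc n then {Suc p} else {})"
    (is "?L = ?R")
proof (rule set_eqI)
  fix i
  consider "i < p" | "i = p" | "i = Suc p" | i' where "i = Suc i'" "p < i'"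
    by (metis less_Suc_eq linorder_neqE_nat Suc_lessE)
  then show "i \<in> ?L \<longleftrightarrow> i \<in> ?R"
  proof cases
    case 1
    then show ?thesis using assms(2) by (auto simp: rDes_def insert_max_def)
  next
    case 2
    then show ?thesis
      using assms(2,3) sym_grp_le[OF assms(1,2)] by (auto simp: rDes_def insert_max_def)
  next
    case 3
    then show ?thesis using assms(2,3) by (auto simp: rDes_def insert_max_def)
  next
    case 4
    then show ?thesis using assms(2,3) by (auto simp: rDes_def insert_max_def)
  qed
qed

text \<open>The maximum can only be the left member of a new pair, and its partners are the letters
  v to its right with n + 1 < v + r.\<close>

lemma card_small_inv_insert_max:
  assumes "\<tau> \<in> sym_grp n" "p \<le> n"
  shows "card (small_inv r (Suc n) (insert_max n p \<tau>))
    = card (small_inv r n \<tau>) + card {j \<in> {p..<n}. Suc n < \<tau> (Suc j) + r}"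
proof -
  \<comment> \<open>\<open>e\<close> sends the position of an old letter to its position after the
    insertion.\<close>
  define e where "e i = (if i \<le> p then i else Suc i)" for i
  let ?\<sigma> = "insert_max n p \<tau>" and ?Z = "{j \<in> {p..<n}. Suc n < \<tau> (Suc j) + r}"
  have e_less: "e i < e j \<longleftrightarrow> i < j" for i j by (auto simp: e_def)
  have e_inj: "e i = e j \<longleftrightarrow> i = j" for i j by (auto simp: e_def)
  have \<sigma>e: "?\<sigma> (e i) = \<tau> i" if "i \<le> n" for i
    using that assms(2) by (auto simp: e_def insert_max_def)
  have \<sigma>p: "?\<sigma> (Suc p) = Suc n" by (simp add: insert_max_def)
  have e_Suc: "Suc p < e i \<longleftrightarrow> p < i" for i by (auto simp: e_def)
  have e_le: "e i \<in> {1..Suc n}" if "i \<in> {1..n}" for i using that by (auto simp: e_def)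
  have e_cases: "i = Suc p \<or> (\<exists>i'\<in>{1..n}. i = e i')" if "i \<in> {1..Suc n}" for i
  proof (cases "i \<le> p")
    case True
    then show ?thesis using that assms(2) by (intro disjI2 bexI[of _ i]) (auto simp: e_def)
  next
    case False
    then show ?thesis
      using that assms(2) by (cases "i = Suc p") (auto simp: e_def intro!: bexI[of _ "i - 1"])
  qed
  have le: "\<tau> i \<le> n" if "i \<in> {1..n}" for i using that sym_grp_le[OF assms(1)] by auto
  have "small_inv r (Suc n) ?\<sigma> = map_prod e e ` small_inv r n \<tau> \<union> (\<lambda>j. (Suc p, Suc (Suc j))) ` ?Z"
    (is "?L = ?R1 \<union> ?R2")
  proof (rule equalityI)
    show "?L \<subseteq> ?R1 \<union> ?R2"
    proof (rule subsetI)
      fix x assume x: "x \<in> ?L"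
      obtain i j where xij: "x = (i, j)" by force
      have ij: "i \<in> {1..Suc n}" "j \<in> {1..Suc n}" "i < j" "?\<sigma> j < ?\<sigma> i" "?\<sigma> i < ?\<sigma> j + r"
        using x xij by (auto simp: small_inv_def)
      have "j \<noteq> Suc p"
      proof
        assume "j = Suc p"
        then have "?\<sigma> j = Suc n" "i \<noteq> Suc p" using ij(3) \<sigma>p by auto
        then show False using e_cases[OF ij(1)] \<sigma>e le ij(4) by fastforce
      qed
      then obtain j' where j': "j' \<in> {1..n}" "j = e j'" using e_cases[OF ij(2)] by auto
      show "x \<in> ?R1 \<union> ?R2"
      proof (cases "i = Suc p")
        case True
        have "p < j'" using ij(3) True j'(2) e_Suc by simp
        then have "j = Suc (Suc (j' - 1))" "j' - 1 \<in> ?Z"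
          using ij(5) True j' \<sigma>e[of j'] \<sigma>p by (auto simp: e_def)
        then show ?thesis using xij True by auto
      next
        case False
        then obtain i' where i': "i' \<in> {1..n}" "i = e i'" using e_cases[OF ij(1)] by auto
        then have "(i', j') \<in> small_inv r n \<tau>"
          using ij j' \<sigma>e by (auto simp: small_inv_def e_less)
        then show ?thesis using xij i' j' by force
      qed
    qed
    show "?R1 \<union> ?R2 \<subseteq> ?L"
    proof (rule Un_least)
      show "?R1 \<subseteq> ?L"
      proof (rule image_subsetI)
        fix x assume "x \<in> small_inv r n \<tau>"
        moreover obtain i j where "x = (i, j)" by force
        ultimately show "map_prod e e x \<in> ?L"
          using e_le by (simp add: small_inv_def \<sigma>e e_less)
      qed
      show "?R2 \<subseteq> ?L"
      proof (rule image_subsetI)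
        fix j assume j: "j \<in> ?Z"
        then have "?\<sigma> (Suc (Suc j)) = \<tau> (Suc j)" "\<tau> (Suc j) \<le> n"
          using sym_grp_le[OF assms(1), of "Suc j"] by (auto simp: insert_max_def)
        then show "(Suc p, Suc (Suc j)) \<in> ?L"
          using j by (auto simp: small_inv_def \<sigma>p)
      qed
    qed
  qed
  moreover have "finite (small_inv r n \<tau>)"
    by (rule finite_subset[of _ "{1..n} \<times> {1..n}"]) (auto simp: small_inv_def)
  moreover have "?R1 \<inter> ?R2 = {}"
    by (auto simp: e_def split: if_splits)
  moreover have "card ?R1 = card (small_inv r n \<tau>)"
    by (rule card_image) (auto simp: inj_on_def e_inj)
  moreover have "card ?R2 = card ?Z"
    by (rule card_image) (auto simp: inj_on_def)
  ultimately show ?thesis by (simp add: card_Un_disjoint)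
qed

lemma rDes_bounds: "a \<in> rDes r n \<tau> \<Longrightarrow> 1 \<le> a \<and> a < n"
  by (auto simp: rDes_def)

lemma finite_rDes: "finite (rDes r n \<tau>)"
  by (rule finite_subset[of _ "{..<n}"]) (auto simp: rDes_def)

text \<open>This keeps the kinds of neutral gaps apart: the letter behind a descent is small enough
  to form a descent with n + 1 as well.\<close>

lemma rDes_next_letter:
  assumes "\<tau> \<in> sym_grp n" "a \<in> rDes r n \<tau>"
  shows "\<tau> (Suc a) + r \<le> n"
  using assms(2) sym_grp_le[OF assms(1), of a] by (auto simp: rDes_def)

lemma card_neutral_gaps_above:
  assumes "\<tau> \<in> sym_grp n" "p \<le> n"
  shows "card {a \<in> neutral_gaps r n \<tau>. p < a} = (if p < n then 1 else 0)
    + card {a \<in> rDes r n \<tau>. p < a} + card {a \<in> {Suc p..<n}. Suc n < \<tau> (Suc a) + r}"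
proof -
  let ?D = "{a \<in> rDes r n \<tau>. p < a}" and ?Z = "{a \<in> {Suc p..<n}. Suc n < \<tau> (Suc a) + r}"
  have eq: "{a \<in> neutral_gaps r n \<tau>. p < a} = ({a. a = n \<and> p < n} \<union> ?D) \<union> ?Z"
    (is "?A = _")
  proof (rule set_eqI)
    fix a
    show "a \<in> ?A \<longleftrightarrow> a \<in> ({a. a = n \<and> p < n} \<union> ?D) \<union> ?Z"
      using rDes_bounds[of a r n \<tau>] by (cases "a \<in> rDes r n \<tau>") (auto simp: neutral_gaps_def)
  qed
  have fin: "finite ?D" using finite_rDes by simp
  have "a \<notin> ?Z" if "a \<in> ?D" for a
    using that rDes_next_letter[OF assms(1), of a r] by auto
  then have "card (({a. a = n \<and> p < n} \<union> ?D) \<union> ?Z) = card ({a. a = n \<and> p < n} \<union> ?D) + card ?Z"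
    using fin by (intro card_Un_disjoint) auto
  also have "n \<notin> ?D" using rDes_bounds[of n r n \<tau>] by auto
  then have "card ({a. a = n \<and> p < n} \<union> ?D) = card {a. a = n \<and> p < n} + card ?D"
    using fin by (intro card_Un_disjoint) auto
  finally show ?thesis unfolding eq by simp
qed

lemma sum_split_at:
  fixes D :: "nat set" and f :: "nat \<Rightarrow> nat"
  assumes "finite D"
  shows "sum f D = sum f {i\<in>D. i < p} + sum f {i\<in>D. p < i} + (if p \<in> D then f p else 0)"
proof -
  have "sum f D = (\<Sum>i\<in>D. (if i < p then f i else 0) + (if p < i then f i else 0)
      + (if i = p then f i else 0))"
    by (intro sum.cong) auto
  then show ?thesis
    using assms by (simp add: sum.distrib sum.inter_filter)
qed

lemma rmaj_alt: "rmaj r n \<sigma> = \<Sum>(rDes r n \<sigma>) + card (small_inv r n \<sigma>)"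
  by (simp add: rmaj_def small_inv_def)

text \<open>Every neutral gap to the right of \<open>p\<close> stands for one unit of
  \<open>rmaj\<close>. A descent there moves one step to the right; a letter v there with n + 1 < v
  + r forms a close inversion with n + 1. The final gap n stands for the unit gained at
  \<open>p\<close> itself when p < n: the descent at \<open>p\<close> moves to p + 1, or the next
  letter forms a close inversion, or a new descent contributes p + 1, which is this unit and the
  extra \<open>p\<close>.\<close>

lemma rmaj_rdes_insert_max:
  assumes "\<tau> \<in> sym_grp n" "p \<le> n" "1 \<le> r"
  defines "A \<equiv> neutral_gaps r n \<tau>"
  shows "rdes r (Suc n) (insert_max n p \<tau>) = rdes r n \<tau> + (if p \<in> A then 0 else 1)"
    and "rmaj r (Suc n) (insert_max n p \<tau>)
      = rmaj r n \<tau> + (if p \<in> A then 0 else p) + card {a \<in> A. p < a}"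
proof -
  let ?D = "rDes r n \<tau>" and ?\<sigma> = "insert_max n p \<tau>"
  let ?c = "p < n \<and> \<tau> (Suc p) + r \<le> Suc n"
  let ?L = "{i \<in> ?D. i < p}" and ?G = "{i \<in> ?D. p < i}"
  have fin: "finite ?L" "finite ?G" using finite_rDes by auto
  have sum_D: "\<Sum>?D = \<Sum>?L + \<Sum>?G + (if p \<in> ?D then p else 0)"
    by (rule sum_split_at[OF finite_rDes])
  have card_D: "card ?D = card ?L + card ?G + (if p \<in> ?D then 1 else 0)"
    using sum_split_at[OF finite_rDes, of "\<lambda>_. 1" r n \<tau> p] by simp
  have R: "rDes r (Suc n) ?\<sigma> = (?L \<union> Suc ` ?G) \<union> {a. a = Suc p \<and> ?c}"
    unfolding rDes_insert_max[OF assms(1-3)] by auto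
  have sum_R: "sum f (rDes r (Suc n) ?\<sigma>)
      = sum f ?L + (\<Sum>i\<in>?G. f (Suc i)) + (if ?c then f (Suc p) else 0)" for f :: "nat \<Rightarrow> nat"
  proof -
    have "sum f (rDes r (Suc n) ?\<sigma>) = sum f (?L \<union> Suc ` ?G) + sum f {a. a = Suc p \<and> ?c}"
      unfolding R by (rule sum.union_disjoint) (use fin in auto)
    also have "sum f (?L \<union> Suc ` ?G) = sum f ?L + sum f (Suc ` ?G)"
      by (rule sum.union_disjoint) (use fin in auto)
    also have "sum f (Suc ` ?G) = (\<Sum>i\<in>?G. f (Suc i))"
      by (subst sum.reindex) simp_all
    also have "{a. a = Suc p \<and> ?c} = (if ?c then {Suc p} else {})" by auto
    finally show ?thesis by (simp split: if_splits)
  qed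
  have card_R: "card (rDes r (Suc n) ?\<sigma>) = card ?L + card ?G + (if ?c then 1 else 0)"
    using sum_R[of "\<lambda>_. 1"] by simp
  have sum_Suc: "(\<Sum>i\<in>?G. Suc i) = \<Sum>?G + card ?G"
    using sum.distrib[of "\<lambda>i. i" "\<lambda>_. 1" ?G] by simp
  have A: "p \<in> A \<longleftrightarrow> (?c \<longrightarrow> p \<in> ?D)"
    using assms(2) by (auto simp: A_def neutral_gaps_def)
  have Dc: "p \<in> ?D \<Longrightarrow> ?c"
    using rDes_next_letter[OF assms(1), of p r] rDes_bounds[of p r n \<tau>] by simp
  show "rdes r (Suc n) ?\<sigma> = rdes r n \<tau> + (if p \<in> A then 0 else 1)"
    unfolding rdes_def card_R card_D using A Dc by (cases "p \<in> ?D"; cases ?c) simp_all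
  have Z: "card {j \<in> {p..<n}. Suc n < \<tau> (Suc j) + r}
      = (if p < n \<and> \<not> ?c then 1 else 0) + card {a \<in> {Suc p..<n}. Suc n < \<tau> (Suc a) + r}"
  proof (cases "p < n")
    case True
    have "{j \<in> {p..<n}. Suc n < \<tau> (Suc j) + r}
      = {j. j = p \<and> \<not> ?c} \<union> {a \<in> {Suc p..<n}. Suc n < \<tau> (Suc a) + r}"
      using True by (auto simp: not_le le_less Suc_le_eq)
    moreover have "card ({j. j = p \<and> \<not> ?c} \<union> {a \<in> {Suc p..<n}. Suc n < \<tau> (Suc a) + r})
      = card {j. j = p \<and> \<not> ?c} + card {a \<in> {Suc p..<n}. Suc n < \<tau> (Suc a) + r}"
      by (rule card_Un_disjoint) auto
    moreover have "card {j. j = p \<and> \<not> ?c} = (if \<not> ?c then 1 else 0)" by (cases ?c) simp_all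
    ultimately show ?thesis using True by simp
  qed simp
  show "rmaj r (Suc n) ?\<sigma> = rmaj r n \<tau> + (if p \<in> A then 0 else p) + card {a \<in> A. p < a}"
    unfolding rmaj_alt card_small_inv_insert_max[OF assms(1,2)] sum_R sum_Suc sum_D Z
      A_def[symmetric] card_neutral_gaps_above[OF assms(1,2), of r, folded A_def]
    using A Dc by (cases "p \<in> ?D"; cases ?c) auto
qed

text \<open>For r \<le> n the neutral gaps are the descents, the gaps in front of the r - 1 largest
  letters, and the final gap. For r > n there are no descents and every gap is neutral, whence the
  minimum.\<close>

lemma card_neutral_gaps:
  assumes "\<tau> \<in> sym_grp n" "1 \<le> r"
  shows "card (neutral_gaps r n \<tau>) = min (Suc n) (rdes r n \<tau> + r)"
proof -
  let ?D = "rDes r n \<tau>" and ?Z = "{a. a < n \<and> Suc n < \<tau> (Suc a) + r}"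
  have eq: "neutral_gaps r n \<tau> = insert n (?D \<union> ?Z)"
    (is "?A = _")
  proof (rule set_eqI)
    fix a
    show "a \<in> ?A \<longleftrightarrow> a \<in> insert n (?D \<union> ?Z)"
      using rDes_bounds[of a r n \<tau>] by (cases "a \<in> ?D") (auto simp: neutral_gaps_def)
  qed
  have "a \<notin> ?Z" if "a \<in> ?D" for a
    using that rDes_next_letter[OF assms(1), of a r] by auto
  then have disj: "?D \<inter> ?Z = {}" by blast
  have "n \<notin> ?D \<union> ?Z" using rDes_bounds[of n r n \<tau>] by auto
  moreover have finZ: "finite ?Z" by simp
  ultimately have card: "card (neutral_gaps r n \<tau>) = Suc (rdes r n \<tau> + card ?Z)"
    unfolding eq rdes_def using disj finite_rDes[of r n \<tau>] by (simp add: card_Un_disjoint)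
  have "bij_betw \<tau> {1..n} {1..n}"
    using assms(1) by (auto simp: sym_grp_def permutes_imp_bij)
  then have "bij_betw (\<lambda>a. \<tau> (Suc a)) {..<n} {1..n}"
    using bij_betw_trans[of Suc "{..<n}" "{1..n}" \<tau> "{1..n}"]
    by (simp add: comp_def bij_betw_def image_Suc_lessThan)
  from card_bij_betw_filter[OF this, of "\<lambda>v. Suc n < v + r"]
  have "card ?Z = card {v \<in> {1..n}. Suc n < v + r}" by simp
  also have "{v \<in> {1..n}. Suc n < v + r} = {max 1 (n + 2 - r)..n}" by auto
  also have "card \<dots> = min n (r - 1)" using assms(2) by simp
  finally have Z: "card ?Z = min n (r - 1)" .
  show ?thesis
  proof (cases "r \<le> n")
    case True
    have "neutral_gaps r n \<tau> \<subseteq> {..n}" by (auto simp: neutral_gaps_def)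
    from card_mono[OF _ this] have "card (neutral_gaps r n \<tau>) \<le> Suc n" by simp
    then show ?thesis using card Z True assms(2) by auto
  next
    case False
    then have "a \<notin> ?D" for a using rDes_next_letter[OF assms(1), of a r] by auto
    then have "?D = {}" by blast
    then show ?thesis using card Z False assms(2) by (simp add: rdes_def)
  qed
qed

lemma sum_lessThan_split:
  fixes f :: "nat \<Rightarrow> 'a::comm_monoid_add"
  shows "m \<le> n \<Longrightarrow> sum f {..<n} = sum f {m..<n} + sum f {..<m}"
  using sum.atLeastLessThan_concat[of 0 m n f] by (simp add: lessThan_atLeast0 add.commute)

text \<open>The two rank sums give the neutral gaps the increments below their number and the other
  gaps the rest. The minimum in \<open>card_neutral_gaps\<close> leaves no trace, since
  \<open>c\<close> never exceeds n.\<close>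

lemma sum_rdes_rmaj_Suc:
  fixes q :: "'a::comm_semiring_1"
  assumes "1 \<le> r"
  shows "(\<Sum>\<sigma>\<in>sym_grp (Suc n). w (rdes r (Suc n) \<sigma>) * q ^ rmaj r (Suc n) \<sigma>)
    = (\<Sum>\<tau>\<in>sym_grp n. (\<Sum>c<Suc n. w (if c < rdes r n \<tau> + r then rdes r n \<tau> else Suc (rdes r n \<tau>)) * q ^ c)
        * q ^ rmaj r n \<tau>)"
  unfolding sum_sym_grp_Suc
proof (rule sum.cong[OF refl])
  fix \<tau> assume \<tau>: "\<tau> \<in> sym_grp n"
  define A where "A = neutral_gaps r n \<tau>"
  define k where "k = rdes r n \<tau>"
  define F where "F p = w (rdes r (Suc n) (insert_max n p \<tau>)) * q ^ rmaj r (Suc n) (insert_max n p \<tau>)" for p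
  have sub: "A \<subseteq> {..<Suc n}" by (auto simp: A_def neutral_gaps_def)
  have cardA: "card A = min (Suc n) (k + r)"
    using card_neutral_gaps[OF \<tau> assms] by (simp add: A_def k_def)
  have in_A: "F p = w k * q ^ card {a \<in> A. p < a} * q ^ rmaj r n \<tau>" if "p \<in> A" for p
    using that sub rmaj_rdes_insert_max[OF \<tau> _ assms, of p]
    by (auto simp: F_def A_def k_def power_add mult_ac)
  have notin_A: "F p = w (Suc k) * q ^ (p + card {a \<in> A. p < a}) * q ^ rmaj r n \<tau>"
    if "p \<in> {..<Suc n} - A" for p
    using that rmaj_rdes_insert_max[OF \<tau> _ assms, of p]
    by (auto simp: F_def A_def k_def power_add mult_ac)
  have "(\<Sum>p<Suc n. F p) = (\<Sum>p\<in>{..<Suc n} - A. F p) + (\<Sum>p\<in>A. F p)"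
    using sum.subset_diff[OF sub] by simp
  also have "(\<Sum>p\<in>A. F p) = (\<Sum>p\<in>A. (\<lambda>c. w k * q ^ c) (card {a \<in> A. p < a})) * q ^ rmaj r n \<tau>"
    by (simp add: in_A sum_distrib_right)
  also have "\<dots> = (\<Sum>c<card A. w k * q ^ c) * q ^ rmaj r n \<tau>"
    using finite_subset[OF sub] by (subst sum_rank_above) auto
  also have "(\<Sum>p\<in>{..<Suc n} - A. F p)
      = (\<Sum>p\<in>{..<Suc n} - A. (\<lambda>c. w (Suc k) * q ^ c) (p + card {a \<in> A. p < a})) * q ^ rmaj r n \<tau>"
    by (simp add: notin_A sum_distrib_right)
  also have "\<dots> = (\<Sum>c\<in>{card A..<Suc n}. w (Suc k) * q ^ c) * q ^ rmaj r n \<tau>"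
    by (subst sum_corank_above[OF sub]) simp
  also have "(\<Sum>c\<in>{card A..<Suc n}. w (Suc k) * q ^ c) * q ^ rmaj r n \<tau>
      + (\<Sum>c<card A. w k * q ^ c) * q ^ rmaj r n \<tau>
      = (\<Sum>c<Suc n. w (if c < k + r then k else Suc k) * q ^ c) * q ^ rmaj r n \<tau>"
  proof -
    let ?f = "\<lambda>c. w (if c < k + r then k else Suc k) * q ^ c"
    have "sum ?f {..<Suc n} = sum ?f {card A..<Suc n} + sum ?f {..<card A}"
      using sum_lessThan_split[of "card A" "Suc n" ?f] cardA by simp
    also have "(\<Sum>c\<in>{card A..<Suc n}. w (if c < k + r then k else Suc k) * q ^ c)
        = (\<Sum>c\<in>{card A..<Suc n}. w (Suc k) * q ^ c)"
      using cardA by (intro sum.cong) auto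
    also have "(\<Sum>c<card A. w (if c < k + r then k else Suc k) * q ^ c) = (\<Sum>c<card A. w k * q ^ c)"
      using cardA by (intro sum.cong) auto
    finally show ?thesis by (simp add: distrib_right)
  qed
  finally show "(\<Sum>p<Suc n. w (rdes r (Suc n) (insert_max n p \<tau>)) * q ^ rmaj r (Suc n) (insert_max n p \<tau>))
    = (\<Sum>c<Suc n. w (if c < rdes r n \<tau> + r then rdes r n \<tau> else Suc (rdes r n \<tau>)) * q ^ c) * q ^ rmaj r n \<tau>"
    by (simp only: F_def k_def)
qed

section \<open>Products of q-integers for excedance classes\<close>

text \<open>Integer arguments let slot counts be lowered by 1 without truncation; a negative count
  stands for an impossible choice and yields 0.\<close>

definition qint :: "'a::comm_semiring_1 \<Rightarrow> int \<Rightarrow> 'a" where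
  "qint q z = qbr q (nat z)"

lemma qint_nonpos: "z \<le> 0 \<Longrightarrow> qint q z = 0"
  by (simp add: qint_def)

lemma qint_top:
  assumes "1 \<le> z" shows "qint q z = qint q (z - 1) + q ^ nat (z - 1)"
proof -
  have "nat z = Suc (nat (z - 1))" using assms by simp
  then show ?thesis by (simp add: qint_def qbr_Suc)
qed

lemma qint_bottom:
  assumes "1 \<le> z" shows "qint q z = 1 + q * qint q (z - 1)"
proof -
  have "nat z = Suc (nat (z - 1))" using assms by simp
  then show ?thesis by (simp add: qint_def qbr_Suc')
qed

text \<open>
  With \<^term>\<open>f\<close> the slots of the larger class, \<open>P (Suc j)\<close> and \<open>qint q (B x) * X x\<close> are, up to a
  common factor, the weights of the smaller classes obtained by replacing the largest excedance
  value by \<open>j + g\<close>, respectively by deleting it together with the position \<open>x\<close>.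
\<close>

lemma telescope:
  fixes q :: "'a::comm_semiring_1" and f B :: "nat \<Rightarrow> int" and \<alpha> u :: "nat \<Rightarrow> nat" and E V :: "nat set" and m :: nat
  defines "P \<equiv> \<lambda>y. (\<Prod>i\<in>{1..<y}. qint q (f i)) * (\<Prod>i\<in>{y..m}. qint q (f i - 1))"
    and "X \<equiv> \<lambda>y. (\<Prod>i\<in>{1..<y}. qint q (f i)) * (\<Prod>i\<in>{Suc y..m}. qint q (f i - 1))"
  assumes P1: "P 1 = 0"
    and \<alpha>: "\<And>y. y \<in> {1..m} \<Longrightarrow> \<alpha> y = \<alpha> (Suc y) + (if y \<in> E then 1 else 0)"
    and B: "\<And>y. y \<in> {1..m} \<Longrightarrow>
      B (Suc y) = B y - 1 + (if y \<in> E then 1 else 0) + (if y \<in> V then 1 else 0)"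
    and B_out: "\<And>y. y \<in> {1..m} \<Longrightarrow> y \<notin> E \<Longrightarrow> B y = f y"
    and B_in: "\<And>y. y \<in> {1..m} \<Longrightarrow> y \<in> E \<Longrightarrow> f y \<le> B y"
    and X0: "\<And>y. y \<in> {1..m} \<Longrightarrow> y \<in> E \<Longrightarrow> f y \<le> 0 \<Longrightarrow> X y = 0"
    and u: "\<And>y. y \<in> {1..m} \<Longrightarrow> y \<in> V \<Longrightarrow> int (u y) = int (\<alpha> (Suc y)) + B (Suc y) - 1"
    and y: "1 \<le> y" "y \<le> Suc m"
  shows "(\<Sum>x\<in>E \<inter> {1..<y}. q ^ \<alpha> (Suc x) * (qint q (B x) * X x))
      + (\<Sum>j\<in>V \<inter> {1..<y}. q ^ u j * P (Suc j)) = q ^ \<alpha> y * (qint q (B y) * P y)"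
  using y
proof (induction y rule: dec_induct)
  case base
  then show ?case using P1 by simp
next
  case (step y)
  then have ym: "y \<in> {1..m}" by simp
  then have "{y..m} = insert y {Suc y..m}" "{1..<Suc y} = insert y {1..<y}" by auto
  then have Py: "P y = qint q (f y - 1) * X y" and PSy: "P (Suc y) = qint q (f y) * X y"
    by (simp_all add: P_def X_def mult_ac)
  define \<beta> where "\<beta> = \<alpha> (Suc y)"
  have ins: "S \<inter> {1..<Suc y} = (if y \<in> S then insert y (S \<inter> {1..<y}) else S \<inter> {1..<y})" for S
    using ym by (auto simp: less_Suc_eq)
  have "(\<Sum>x\<in>E \<inter> {1..<Suc y}. q ^ \<alpha> (Suc x) * (qint q (B x) * X x))
      + (\<Sum>j\<in>V \<inter> {1..<Suc y}. q ^ u j * P (Suc j))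
    = ((\<Sum>x\<in>E \<inter> {1..<y}. q ^ \<alpha> (Suc x) * (qint q (B x) * X x))
      + (\<Sum>j\<in>V \<inter> {1..<y}. q ^ u j * P (Suc j)))
      + (if y \<in> E then q ^ \<beta> * (qint q (B y) * X y) else 0)
      + (if y \<in> V then q ^ u y * P (Suc y) else 0)"
    unfolding ins by (simp add: \<beta>_def ac_simps)
  also have "\<dots> = q ^ \<alpha> y * (qint q (B y) * P y)
      + (if y \<in> E then q ^ \<beta> * (qint q (B y) * X y) else 0)
      + (if y \<in> V then q ^ u y * P (Suc y) else 0)"
    using step by simp
  \<comment> \<open>From y to y + 1 the factor of \<open>P\<close> at y grows from [f y - 1] to
    [f y]. If y is in \<open>E\<close>, its term supplies the missing 1 of
    \<open>qint_bottom\<close>, and the drop of \<alpha> supplies the power of q. If y is in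
    \<open>V\<close>, its term is the top power of \<open>qint_top\<close>; it raises [B y] to
    [B y + 1] when y is in \<open>E\<close> and completes [f y - 1] to [f y] otherwise.\<close>
  also have "\<dots> = q ^ \<beta> * (qint q (B (Suc y)) * P (Suc y))"
  proof (cases "f y \<le> 0")
    case True
    \<comment> \<open>Both \<open>P y\<close> and \<open>P (Suc y)\<close> have a vanishing factor
      here, but the term of a y in \<open>E\<close> has none at y itself; \<open>X0\<close> makes it
      vanish.\<close>
    then show ?thesis
      using X0[OF ym] B_out[OF ym] by (auto simp: Py PSy qint_nonpos)
  next
    case False
    then have f1: "1 \<le> f y" by simp
    have B1: "1 \<le> B y" using f1 B_out[OF ym] B_in[OF ym] by (cases "y \<in> E") auto
    show ?thesis
    proof (cases "y \<in> E")
      case yE: True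
      have 1: "q ^ \<alpha> y * (qint q (B y) * P y) + q ^ \<beta> * (qint q (B y) * X y)
          = q ^ \<beta> * (qint q (B y) * P (Suc y))"
        using \<alpha>[OF ym] yE qint_bottom[OF f1, of q]
        by (simp add: Py PSy \<beta>_def algebra_simps)
      show ?thesis
      proof (cases "y \<in> V")
        case True
        then have BS: "B (Suc y) = B y + 1" using B[OF ym] yE by simp
        then have "int (u y) = int \<beta> + B y" using u[OF ym True] by (simp add: \<beta>_def)
        then have uy: "u y = \<beta> + nat (B y)" using B1 by simp
        have "qint q (B (Suc y)) = qint q (B y) + q ^ nat (B y)"
          using qint_top[of "B y + 1" q] B1 BS by simp
        then show ?thesis
          using 1 yE True uy by (simp add: algebra_simps power_add)
      next
        case False
        then show ?thesis using 1 yE B[OF ym] by simp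
      qed
    next
      case yE: False
      have By: "B y = f y" using B_out[OF ym yE] .
      show ?thesis
      proof (cases "y \<in> V")
        case True
        then have BS: "B (Suc y) = f y" using B[OF ym] yE By by simp
        then have "int (u y) = int \<beta> + (f y - 1)" using u[OF ym True] by (simp add: \<beta>_def)
        then have uy: "u y = \<beta> + nat (f y - 1)" using f1 by simp
        show ?thesis
          using True yE \<alpha>[OF ym] uy BS qint_top[OF f1, of q]
          by (simp add: Py PSy By \<beta>_def algebra_simps power_add)
      next
        case False
        then have BS: "B (Suc y) = f y - 1" using B[OF ym] yE By by simp
        show ?thesis
          using False yE \<alpha>[OF ym] by (simp add: Py PSy By BS \<beta>_def mult_ac)
      qed
    qed
  qed
  finally show ?case by (simp add: \<beta>_def)
qed

section \<open>Slot counts and weights of excedance classes\<close>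

definition thr :: "nat \<Rightarrow> nat \<Rightarrow> nat \<Rightarrow> nat" where
  "thr g h i = max (i + g) h"

text \<open>
  The number of choices for the letter in position \<^term>\<open>i\<close>, when the positions in \<^term>\<open>E\<close> are
  filled from right to left with values from \<^term>\<open>F\<close> that are at least the threshold, and the
  other positions from left to right with the remaining values below it. It can be negative for
  classes that contain no permutation.
\<close>

definition slots :: "nat \<Rightarrow> nat \<Rightarrow> nat \<Rightarrow> nat set \<Rightarrow> nat set \<Rightarrow> nat \<Rightarrow> int" where
  "slots g h n E F i = int (card {v\<in>F. thr g h i \<le> v}) - int (card {j\<in>E. i < j})
     + (if i \<in> E then 0 else int (min (thr g h i) (Suc n)) - int i)"

definition class_weight :: "'a::comm_semiring_1 \<Rightarrow> nat \<Rightarrow> nat \<Rightarrow> nat \<Rightarrow> nat set \<Rightarrow> nat set \<Rightarrow> 'a" where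
  "class_weight q g h n E F = (\<Prod>i\<in>{1..n}. qint q (slots g h n E F i))"

lemma card_insert_filter:
  assumes "finite F" "v \<notin> F"
  shows "card {w\<in>insert v F. P w} = card {w\<in>F. P w} + (if P v then 1 else 0)"
proof -
  have "{w\<in>insert v F. P w} = (if P v then insert v {w\<in>F. P w} else {w\<in>F. P w})" by auto
  then show ?thesis using assms by simp
qed

lemma card_remove_filter:
  assumes "finite E" "x \<in> E"
  shows "card {j\<in>E. P j} = card {j\<in>E - {x}. P j} + (if P x then 1 else 0)"
  using card_insert_filter[of "E - {x}" x P] assms by (simp add: insert_absorb)

text \<open>Beyond \<open>m\<close> the threshold exceeds \<open>n\<close>, so the letter is
  unrestricted. Such positions contribute a q-factorial that is the same for all classes.\<close>

lemma slots_tail: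
  assumes "E \<subseteq> {1..m}" "F \<subseteq> {1..n}" "n \<le> m + g" "m < i"
  shows "slots g h n E F i = int (Suc n) - int i"
proof -
  have "{j\<in>E. i < j} = {}" "{v\<in>F. thr g h i \<le> v} = {}" "i \<notin> E"
    using assms by (fastforce simp: thr_def)+
  moreover have "min (thr g h i) (Suc n) = Suc n" using assms by (auto simp: thr_def)
  ultimately show ?thesis unfolding slots_def by (simp only: card.empty if_False)
qed

lemma class_weight_split:
  assumes "E \<subseteq> {1..m}" "F \<subseteq> {1..n}" "n \<le> m + g" "m \<le> n"
  shows "class_weight q g h n E F
    = (\<Prod>i\<in>{1..m}. qint q (slots g h n E F i)) * (\<Prod>i\<in>{1..n-m}. qint q (int i))"
proof -
  have "{1..n} = {1..m} \<union> {Suc m..n}" using assms(4) by auto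
  then have "class_weight q g h n E F = (\<Prod>i\<in>{1..m}. qint q (slots g h n E F i))
      * (\<Prod>i\<in>{Suc m..n}. qint q (slots g h n E F i))"
    unfolding class_weight_def by (simp add: prod.union_disjoint)
  also have "(\<Prod>i\<in>{Suc m..n}. qint q (slots g h n E F i))
      = (\<Prod>i\<in>{1..n-m}. qint q (int i))"
    by (rule prod.reindex_bij_witness[of _ "\<lambda>i. Suc n - i" "\<lambda>i. Suc n - i"])
      (use slots_tail[OF assms(1-3)] in \<open>auto simp: of_nat_diff\<close>)
  finally show ?thesis .
qed

text \<open>Replacing N + 1 by \<open>v\<close> costs one slot at each position whose threshold
  exceeds \<open>v\<close>. Deleting N + 1 and \<open>x\<close> costs one slot at each position
  right of \<open>x\<close> and turns \<open>x\<close> into a non-excedance position. Up to one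
  exceptional factor, both products agree with \<open>f\<close> before a cut and with f - 1 after
  it, which is the shape required by \<open>telescope\<close>.\<close>

lemma class_weight_insert_max:
  fixes q :: "'a::comm_semiring_1"
  assumes n: "Suc N = m + g" and g: "1 \<le> g" and h: "g < h" "h \<le> Suc N"
    and E: "E \<subseteq> {1..m}" and F: "F \<subseteq> {1..N}" and card: "card E = Suc (card F)"
  shows "class_weight q g h (Suc N) E (insert (Suc N) F)
    = (\<Sum>v\<in>{1..N} - F. q ^ (g + card {w\<in>F. v < w}) * class_weight q g h N E (insert v F))
      + (\<Sum>x\<in>E. q ^ card {j\<in>E. x < j} * class_weight q g h N (E - {x}) F)"
proof -
  let ?a = "thr g h" and ?G = "insert (Suc N) F"
  define f where "f = slots g h (Suc N) E ?G"
  define P where "P y = (\<Prod>i\<in>{1..<y}. qint q (f i)) * (\<Prod>i\<in>{y..m}. qint q (f i - 1))" for y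
  define X where "X y = (\<Prod>i\<in>{1..<y}. qint q (f i)) * (\<Prod>i\<in>{Suc y..m}. qint q (f i - 1))" for y
  define \<alpha> where "\<alpha> y = card {j\<in>E. y \<le> j}" for y
  \<comment> \<open>The slot count of \<open>y\<close> as a non-excedance position: it is
    \<open>f y\<close> for \<open>y\<close> outside E, and for \<open>y\<close> in E it is the count
    at \<open>y\<close> in the smaller class (E - {y}, F).\<close>
  define B where "B y = int (card {w\<in>?G. ?a y \<le> w}) - int (\<alpha> y) + int (?a y) - int y" for y
  \<comment> \<open>The index \<open>j\<close> encodes the replacement value j + g, which lies below
    the threshold of position i exactly if j < i. The index \<open>m\<close> is left out since m + g
    = N + 1.\<close>
  define V where "V = {j\<in>{1..m}. h \<le> j + g \<and> j + g \<notin> ?G}"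
  define u where "u j = g + card {w\<in>F. j + g < w}" for j
  define T where "T = (\<Prod>i\<in>{1..g-1}. qint q (int i))"
  have finE: "finite E" and finF: "finite F" using E F finite_subset by auto
  have Nm: "N - m = g - 1" using n g by simp
  have nF: "Suc N \<notin> F" using F by auto
  have a_le: "?a i \<le> Suc N" if "i \<le> m" for i using that n h by (simp add: thr_def)
  have cardG: "card {w\<in>?G. ?a i \<le> w} = Suc (card {w\<in>F. ?a i \<le> w})" if "i \<le> m" for i
    using card_insert_filter[OF finF nF] a_le[OF that] by simp
  have f: "f i = int (card {w\<in>?G. ?a i \<le> w}) - int (card {j\<in>E. i < j})
      + (if i \<in> E then 0 else int (?a i) - int i)" if "i \<le> m" for i
    using a_le[OF that] by (simp add: f_def slots_def min_def)
  have \<alpha>_eq: "\<alpha> y = card {j\<in>E. y < j} + (if y \<in> E then 1 else 0)" for y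
  proof -
    have "{j\<in>E. y \<le> j} = {j\<in>E. y < j} \<union> {j. j = y \<and> y \<in> E}"
      by (auto simp: le_less)
    moreover have "card ({j\<in>E. y < j} \<union> {j. j = y \<and> y \<in> E})
        = card {j\<in>E. y < j} + card {j. j = y \<and> y \<in> E}"
      using finE by (intro card_Un_disjoint) auto
    ultimately show ?thesis by (cases "y \<in> E") (simp_all add: \<alpha>_def)
  qed
  have \<alpha>_Suc: "\<alpha> (Suc y) = card {j\<in>E. y < j}" for y by (simp add: \<alpha>_def Suc_le_eq)
  have Bf: "B y = f y + (if y \<in> E then int (?a y) - int y - 1 else 0)" if "y \<le> m" for y
    using f[OF that] \<alpha>_eq[of y] by (auto simp: B_def)
  \<comment> \<open>The leftmost excedance position has card F others to its right, hence at most
    one slot, and lowering that count leaves none.\<close>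
  have P1: "P 1 = 0"
  proof -
    have ne: "E \<noteq> {}" using card by auto
    define x where "x = Min E"
    have x: "x \<in> E" "\<And>j. j \<in> E \<Longrightarrow> x \<le> j" using ne finE by (auto simp: x_def)
    then have "{j\<in>E. x < j} = E - {x}" by (auto simp: le_less)
    then have "card {j\<in>E. x < j} = card F" using x(1) card by simp
    moreover have "card {w\<in>F. ?a x \<le> w} \<le> card F" using finF by (intro card_mono) auto
    moreover have xm: "x \<in> {1..m}" using x(1) E by auto
    ultimately have "f x \<le> 1" using f[of x] cardG[of x] x(1) by simp
    then have "qint q (f x - 1) = 0" by (simp add: qint_nonpos)
    then show ?thesis using xm by (auto simp: P_def intro!: prod_zero)
  qed
  have tel: "(\<Sum>x\<in>E \<inter> {1..<Suc m}. q ^ \<alpha> (Suc x) * (qint q (B x) * X x))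
      + (\<Sum>j\<in>V \<inter> {1..<Suc m}. q ^ u j * P (Suc j)) = q ^ \<alpha> (Suc m) * (qint q (B (Suc m)) * P (Suc m))"
    unfolding P_def X_def
  proof (rule telescope[where f = f])
    show "(\<Prod>i\<in>{1..<1}. qint q (f i)) * (\<Prod>i\<in>{1..m}. qint q (f i - 1)) = 0"
      using P1 by (simp add: P_def)
    fix y assume y: "y \<in> {1..m}"
    then have ym: "y \<le> m" by simp
    show "\<alpha> y = \<alpha> (Suc y) + (if y \<in> E then 1 else 0)"
      using \<alpha>_eq \<alpha>_Suc by simp
    show "B (Suc y) = B y - 1 + (if y \<in> E then 1 else 0) + (if y \<in> V then 1 else 0)"
    proof (cases "h \<le> y + g")
      case True
      have "{w\<in>?G. y + g \<le> w} = {w\<in>?G. Suc (y + g) \<le> w} \<union> {w. w = y + g \<and> y + g \<in> ?G}"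
        by (auto simp: Suc_le_eq le_less)
      moreover have "card ({w\<in>?G. Suc (y + g) \<le> w} \<union> {w. w = y + g \<and> y + g \<in> ?G})
          = card {w\<in>?G. Suc (y + g) \<le> w} + card {w. w = y + g \<and> y + g \<in> ?G}"
        using finF by (intro card_Un_disjoint) auto
      moreover have "card {w. w = y + g \<and> y + g \<in> ?G} = (if y \<in> V then 0 else 1)"
        using True y by (auto simp: V_def)
      moreover have "?a y = y + g" "?a (Suc y) = Suc (y + g)" using True by (auto simp: thr_def)
      ultimately show ?thesis
        using \<alpha>_eq[of y] \<alpha>_Suc[of y] by (simp add: B_def)
    next
      case False
      then have "?a (Suc y) = ?a y" "y \<notin> V" by (auto simp: thr_def V_def)
      then show ?thesis using \<alpha>_eq[of y] \<alpha>_Suc[of y] by (simp add: B_def)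
    qed
    show "y \<notin> E \<Longrightarrow> B y = f y" using Bf[OF ym] by simp
    show "y \<in> E \<Longrightarrow> f y \<le> B y" using Bf[OF ym] g by (simp add: thr_def)
    \<comment> \<open>Since N + 1 reaches the threshold of \<open>y\<close>, f y \<le> 0 forces a
      next excedance position z. Its threshold is no lower and one competitor is gone, so f z \<le>
      f y + 1 \<le> 1.\<close>
    show "(\<Prod>i\<in>{1..<y}. qint q (f i)) * (\<Prod>i\<in>{Suc y..m}. qint q (f i - 1)) = 0"
      if "y \<in> E" "f y \<le> 0"
    proof -
      let ?S = "{j\<in>E. y < j}"
      have "?S \<noteq> {}"
      proof
        assume "?S = {}"
        then have "card ?S = 0" by (simp only: card.empty)
        then show False using that f[OF ym] cardG[OF ym] by simp
      qed
      moreover define z where "z = Min ?S"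
      ultimately have z: "z \<in> ?S" "\<And>j. j \<in> ?S \<Longrightarrow> z \<le> j"
        using finE Min_in[of ?S] by auto
      then have "?S = insert z {j\<in>E. z < j}" by (auto simp: le_less)
      then have 1: "card ?S = Suc (card {j\<in>E. z < j})" using finE by simp
      have zm: "z \<in> {Suc y..m}" using z(1) E by auto
      have "?a y \<le> ?a z" using z(1) by (auto simp: thr_def)
      then have "card {w\<in>?G. ?a z \<le> w} \<le> card {w\<in>?G. ?a y \<le> w}"
        using finF by (intro card_mono) auto
      then have "f z - 1 \<le> 0" using 1 that f[OF ym] f[of z] z(1) zm by simp
      then have "qint q (f z - 1) = 0" by (rule qint_nonpos)
      then have "(\<Prod>i\<in>{Suc y..m}. qint q (f i - 1)) = 0" using zm by (intro prod_zero) auto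
      then show ?thesis by simp
    qed
    show "int (u y) = int (\<alpha> (Suc y)) + B (Suc y) - 1" if "y \<in> V"
    proof -
      have "?a (Suc y) = Suc (y + g)" using that by (auto simp: V_def thr_def)
      moreover have "y + g < Suc N" using that ym n by (auto simp: V_def le_less)
      then have "card {w\<in>?G. Suc (y + g) \<le> w} = Suc (card {w\<in>F. y + g < w})"
        using card_insert_filter[OF finF nF, of "\<lambda>w. y + g < w"] by (simp add: Suc_le_eq)
      ultimately show ?thesis by (simp add: B_def u_def)
    qed
  qed auto
  have src_v: "class_weight q g h N E (insert v F) = (\<Prod>i\<in>{1..m}. qint q (f i - (if v < ?a i then 1 else 0))) * T"
    if v: "v \<in> {1..N} - F" for v
  proof -
    have "slots g h N E (insert v F) i = f i - (if v < ?a i then 1 else 0)" if "i \<in> {1..m}" for i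
      using that f[of i] cardG[of i] a_le[of i] v card_insert_filter[OF finF, of v "\<lambda>w. ?a i \<le> w"]
      by (auto simp: slots_def min_def)
    then show ?thesis
      using class_weight_split[of E m "insert v F" N g q h] E F v n g
      by (simp add: T_def Nm)
  qed
  have src_x: "class_weight q g h N (E - {x}) F = qint q (B x) * X x * T" if x: "x \<in> E" for x
  proof -
    have xm: "x \<in> {1..m}" using x E by auto
    have slot: "slots g h N (E - {x}) F i
        = (if i < x then f i else if i = x then B x else f i - 1)" if "i \<in> {1..m}" for i
      using that x f[of i] cardG[of i] a_le[of i] card_remove_filter[OF finE x, of "\<lambda>j. i < j"]
        Bf[of i] by (auto simp: slots_def min_def)
    have "{1..m} = {1..<x} \<union> insert x {Suc x..m}" using xm by auto
    then have "(\<Prod>i\<in>{1..m}. qint q (slots g h N (E - {x}) F i))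
        = (\<Prod>i\<in>{1..<x}. qint q (slots g h N (E - {x}) F i))
          * (\<Prod>i\<in>insert x {Suc x..m}. qint q (slots g h N (E - {x}) F i))"
      by (simp only:) (rule prod.union_disjoint; auto)
    also have "(\<Prod>i\<in>{1..<x}. qint q (slots g h N (E - {x}) F i)) = (\<Prod>i\<in>{1..<x}. qint q (f i))"
      using xm by (intro prod.cong) (auto simp: slot)
    also have "(\<Prod>i\<in>insert x {Suc x..m}. qint q (slots g h N (E - {x}) F i))
        = qint q (B x) * (\<Prod>i\<in>{Suc x..m}. qint q (slots g h N (E - {x}) F i))"
      using xm by (simp add: slot)
    also have "(\<Prod>i\<in>{Suc x..m}. qint q (slots g h N (E - {x}) F i)) = (\<Prod>i\<in>{Suc x..m}. qint q (f i - 1))"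
      using xm by (intro prod.cong) (auto simp: slot)
    also have "(\<Prod>i\<in>{1..<x}. qint q (f i)) * (qint q (B x) * (\<Prod>i\<in>{Suc x..m}. qint q (f i - 1)))
        = qint q (B x) * X x"
      by (simp add: X_def mult_ac)
    finally show ?thesis
      using class_weight_split[of "E - {x}" m F N g q h] E F n g
      by (auto simp: T_def Nm)
  qed
  have sum_v: "(\<Sum>v\<in>{1..N} - F. q ^ (g + card {w\<in>F. v < w}) * class_weight q g h N E (insert v F))
      = (\<Sum>j\<in>V. q ^ u j * P (Suc j)) * T"
  proof -
    let ?t = "\<lambda>v. q ^ (g + card {w\<in>F. v < w}) * class_weight q g h N E (insert v F)"
    \<comment> \<open>An excedance value below \<^term>\<open>h\<close> is impossible, so these classes are empty.\<close>
    have zero: "?t v = 0" if v: "v \<in> ({1..N} - F) - {v \<in> {1..N} - F. h \<le> v}" for v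
    proof -
      have "v < ?a i" for i using v by (auto simp: thr_def)
      then have "(\<Prod>i\<in>{1..m}. qint q (f i - (if v < ?a i then 1 else 0))) = P 1"
        by (simp add: P_def)
      then show ?thesis using src_v[of v] v P1 by simp
    qed
    have "(\<Sum>v\<in>{1..N} - F. ?t v) = (\<Sum>v\<in>{v \<in> {1..N} - F. h \<le> v}. ?t v)"
      by (rule sum.mono_neutral_right) (use zero in blast)+
    also have "\<dots> = (\<Sum>j\<in>V. q ^ u j * (P (Suc j) * T))"
    proof (rule sum.reindex_bij_witness[of _ "\<lambda>j. j + g" "\<lambda>v. v - g"])
      fix v assume v: "v \<in> {v \<in> {1..N} - F. h \<le> v}"
      then obtain j where j: "v = j + g" using h(1) by (metis add.commute le_add_diff_inverse less_imp_le order.trans mem_Collect_eq)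
      have jm: "j \<in> {1..m}" using v h(1) n j by auto
      show "v - g \<in> V" using v h(1) n by (auto simp: V_def)
      show "v - g + g = v" using j by simp
      have "v < ?a i \<longleftrightarrow> j < i" for i using v j by (auto simp: thr_def)
      then have eq: "(\<Prod>i\<in>{1..m}. qint q (f i - (if v < ?a i then 1 else 0)))
          = (\<Prod>i\<in>{1..m}. qint q (f i - (if j < i then 1 else 0)))" by simp
      have "{1..m} = {1..<Suc j} \<union> {Suc j..m}" using jm by auto
      then have "(\<Prod>i\<in>{1..m}. qint q (f i - (if j < i then 1 else 0)))
          = (\<Prod>i\<in>{1..<Suc j}. qint q (f i - (if j < i then 1 else 0)))
            * (\<Prod>i\<in>{Suc j..m}. qint q (f i - (if j < i then 1 else 0)))"
        by (simp only:) (rule prod.union_disjoint; auto)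
      also have "\<dots> = P (Suc j)"
        unfolding P_def by (intro arg_cong2[of _ _ _ _ "(*)"] prod.cong) auto
      finally have "class_weight q g h N E (insert v F) = P (Suc j) * T"
        using src_v[of v] v eq by simp
      then show "q ^ u (v - g) * (P (Suc (v - g)) * T) = ?t v"
        using j by (simp add: u_def)
    next
      fix j assume "j \<in> V"
      then show "j + g - g = j" "j + g \<in> {v \<in> {1..N} - F. h \<le> v}"
        using n by (auto simp: V_def le_Suc_eq)
    qed
    also have "\<dots> = (\<Sum>j\<in>V. q ^ u j * P (Suc j)) * T"
      by (simp add: sum_distrib_right mult.assoc)
    finally show ?thesis .
  qed
  have sum_x: "(\<Sum>x\<in>E. q ^ card {j\<in>E. x < j} * class_weight q g h N (E - {x}) F)
      = (\<Sum>x\<in>E. q ^ \<alpha> (Suc x) * (qint q (B x) * X x)) * T"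
    by (simp add: src_x \<alpha>_Suc sum_distrib_right mult.assoc)
  have "E \<inter> {1..<Suc m} = E" "V \<inter> {1..<Suc m} = V" using E by (auto simp: V_def)
  with tel have tel': "(\<Sum>j\<in>V. q ^ u j * P (Suc j)) + (\<Sum>x\<in>E. q ^ \<alpha> (Suc x) * (qint q (B x) * X x))
      = q ^ \<alpha> (Suc m) * (qint q (B (Suc m)) * P (Suc m))"
    by (simp add: add.commute)
  have "{j\<in>E. Suc m \<le> j} = {}" using E by auto
  then have \<alpha>m: "\<alpha> (Suc m) = 0" by (simp only: \<alpha>_def card.empty)
  have am: "?a (Suc m) = Suc (Suc N)" using n h by (simp add: thr_def)
  then have "{w\<in>?G. ?a (Suc m) \<le> w} = {}" using F by auto
  then have "card {w\<in>?G. ?a (Suc m) \<le> w} = 0" by (simp only: card.empty)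
  \<comment> \<open>The telescoping sum thus ends with [g], the factor by which the tail of size N +
    1 exceeds the tail \<open>T\<close> of size N.\<close>
  then have Bm: "B (Suc m) = int g" unfolding B_def am \<alpha>m using n by simp
  have "{1..g} = insert g {1..g-1}" using g by auto
  then have prod_g: "(\<Prod>i\<in>{1..g}. qint q (int i)) = qint q (int g) * T"
    using g by (simp add: T_def)
  have "class_weight q g h (Suc N) E ?G = (\<Prod>i\<in>{1..m}. qint q (f i)) * (qint q (int g) * T)"
  proof -
    have G: "?G \<subseteq> {1..Suc N}" using F by auto
    have "Suc N - m = g" "Suc N \<le> m + g" "m \<le> Suc N" using n by simp_all
    then show ?thesis
      using class_weight_split[OF E G, of g q h] prod_g
      unfolding f_def by simp
  qed
  also have "\<dots> = qint q (int g) * P (Suc m) * T"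
    by (simp add: P_def mult_ac atLeastLessThanSuc_atLeastAtMost)
  also have "\<dots> = ((\<Sum>j\<in>V. q ^ u j * P (Suc j)) + (\<Sum>x\<in>E. q ^ \<alpha> (Suc x) * (qint q (B x) * X x))) * T"
    using tel' \<alpha>m Bm by simp
  also have "\<dots> = (\<Sum>v\<in>{1..N} - F. q ^ (g + card {w\<in>F. v < w}) * class_weight q g h N E (insert v F))
      + (\<Sum>x\<in>E. q ^ card {j\<in>E. x < j} * class_weight q g h N (E - {x}) F)"
    unfolding sum_v sum_x by (simp add: distrib_right)
  finally show ?thesis .
qed

section \<open>The statistic den on excedance classes\<close>

lemma inv_word_map_sorted:
  assumes "sorted_wrt (<) xs"
  shows "inv_word (map \<sigma> xs) = invs (set xs) \<sigma>"
proof -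
  let ?I = "{(i, j). i < j \<and> j < length xs \<and> \<sigma> (xs ! i) > \<sigma> (xs ! j)}"
  let ?f = "\<lambda>(i, j). (xs ! i, xs ! j)"
  have d: "distinct xs" using assms by (simp add: strict_sorted_iff)
  have less: "xs ! i < xs ! j \<longleftrightarrow> i < j" if "i < length xs" "j < length xs" for i j
    using that sorted_wrt_nth_less[OF assms, of i j] sorted_wrt_nth_less[OF assms, of j i]
    by (cases i j rule: linorder_cases) auto
  have "inj_on ?f ?I"
    using d by (auto simp: inj_on_def nth_eq_iff_index_eq)
  then have "card (?f ` ?I) = card ?I" by (rule card_image)
  moreover have "?f ` ?I = {(i, j). i \<in> set xs \<and> j \<in> set xs \<and> i < j \<and> \<sigma> j < \<sigma> i}"
  proof (rule equalityI)
    show "?f ` ?I \<subseteq> {(i, j). i \<in> set xs \<and> j \<in> set xs \<and> i < j \<and> \<sigma> j < \<sigma> i}"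
      using less by auto
    show "{(i, j). i \<in> set xs \<and> j \<in> set xs \<and> i < j \<and> \<sigma> j < \<sigma> i} \<subseteq> ?f ` ?I"
    proof (clarify)
      fix x y assume "x \<in> set xs" "y \<in> set xs" and xy: "x < y" "\<sigma> y < \<sigma> x"
      then obtain i j where ij: "i < length xs" "x = xs ! i" "j < length xs" "y = xs ! j"
        by (auto simp: in_set_conv_nth)
      then have "(i, j) \<in> ?I" using xy less by auto
      then show "(x, y) \<in> ?f ` ?I" using ij by force
    qed
  qed
  moreover have "{(i, j). i < j \<and> j < length (map \<sigma> xs) \<and> map \<sigma> xs ! i > map \<sigma> xs ! j} = ?I"
    by auto
  ultimately show ?thesis by (simp add: inv_word_def invs_def)
qed

lemma den_alt:
  "den g h n \<sigma> = (\<Sum>i\<in>Exclp g h n \<sigma>. i + g - 1)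
    + invs (Exclp g h n \<sigma>) \<sigma> + invs ({1..n} - Exclp g h n \<sigma>) \<sigma>"
proof -
  have sorted: "sorted_wrt (<) (filter P [1..<n+1])" for P
    by (intro sorted_wrt_filter sorted_wrt_upt)
  have "set (filter (\<lambda>i. i \<in> Exclp g h n \<sigma>) [1..<n+1]) = Exclp g h n \<sigma>"
    by (auto simp: Exclp_def)
  moreover have "set (filter (\<lambda>i. i \<notin> Exclp g h n \<sigma>) [1..<n+1]) = {1..n} - Exclp g h n \<sigma>"
    by auto
  ultimately show ?thesis
    unfolding den_def EXCL_def NEXCL_def by (simp only: inv_word_map_sorted[OF sorted])
qed

lemma Exclp_thr: "Exclp g h n \<sigma> = {i\<in>{1..n}. thr g h i \<le> \<sigma> i}"
  by (auto simp: Exclp_def thr_def)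

text \<open>At a position i \<ge> l an excedance letter is at least i + g \<ge> g + l \<ge> h. Hence
  \<open>exc\<close> is constant on each class.\<close>

lemma exc_alt:
  assumes "h \<le> g + l"
  shows "exc g l n \<sigma> = card {i \<in> Exclp g h n \<sigma>. l \<le> i}"
  unfolding exc_def Exclp_def using assms by (intro arg_cong[where f = card]) auto

lemma den_max: "den g (max h (Suc g)) n \<sigma> = den g h n \<sigma>"
proof -
  have "Exclp g (max h (Suc g)) n \<sigma> = Exclp g h n \<sigma>" by (auto simp: Exclp_def)
  then show ?thesis by (simp add: den_alt)
qed

text \<open>\<open>den\<close> counts inversions separately on E and on its complement, so the two
  restrictions of \<sigma> vary independently. The threshold conditions say that the excedance set
  is exactly E.\<close>

lemma sum_class:
  fixes q :: "'a::comm_semiring_1"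
  assumes "E \<subseteq> {1..n}" "F \<subseteq> {1..n}"
  shows "(\<Sum>\<sigma>\<in>{\<sigma>\<in>sym_grp n. Exclp g h n \<sigma> = E \<and> \<sigma> ` E = F}. q ^ (invs E \<sigma> + invs ({1..n} - E) \<sigma>))
    = (\<Sum>s\<in>bijs E F. if \<forall>i\<in>E. thr g h i \<le> s i then q ^ invs E s else 0)
      * (\<Sum>s\<in>bijs ({1..n} - E) ({1..n} - F).
          if \<forall>i\<in>{1..n} - E. s i < thr g h i then q ^ invs ({1..n} - E) s else 0)"
proof -
  let ?E = "{1..n} - E" and ?F = "{1..n} - F"
  let ?A = "{s\<in>bijs E F. \<forall>i\<in>E. thr g h i \<le> s i}"
  let ?B = "{s\<in>bijs ?E ?F. \<forall>i\<in>?E. s i < thr g h i}"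
  let ?S = "{\<sigma>\<in>sym_grp n. Exclp g h n \<sigma> = E \<and> \<sigma> ` E = F}"
  define glue where "glue s t i = (if i \<in> E then s i else if i \<in> {1..n} then t i else i)"
    for s t :: "nat \<Rightarrow> nat" and i
  have fin: "finite E" "finite F" using assms finite_subset by auto
  have "(\<Sum>s\<in>bijs E F. if \<forall>i\<in>E. thr g h i \<le> s i then q ^ invs E s else 0)
      * (\<Sum>s\<in>bijs ?E ?F. if \<forall>i\<in>?E. s i < thr g h i then q ^ invs ?E s else 0)
    = (\<Sum>s\<in>?A. q ^ invs E s) * (\<Sum>t\<in>?B. q ^ invs ?E t)"
    using fin by (simp add: sum.inter_filter finite_bijs del: One_nat_def)
  also have "\<dots> = (\<Sum>(s, t)\<in>?A \<times> ?B. q ^ invs E s * q ^ invs ?E t)"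
    by (simp add: sum_product sum.cartesian_product)
  also have "\<dots> = (\<Sum>\<sigma>\<in>?S. q ^ (invs E \<sigma> + invs ?E \<sigma>))"
  proof (rule sum.reindex_bij_witness
      [of _ "\<lambda>\<sigma>. (restrict \<sigma> E, restrict \<sigma> ?E)" "\<lambda>(s, t). glue s t"])
    fix st assume "st \<in> ?A \<times> ?B"
    then obtain s t where st: "st = (s, t)" and s: "bij_betw s E F" "s \<in> extensional E"
      "\<And>i. i \<in> E \<Longrightarrow> thr g h i \<le> s i" and t: "bij_betw t ?E ?F" "t \<in> extensional ?E"
      "\<And>i. i \<in> ?E \<Longrightarrow> t i < thr g h i"
      by (auto simp: bijs_def)
    have gs: "glue s t i = s i" if "i \<in> E" for i using that by (simp add: glue_def)
    have gt: "glue s t i = t i" if "i \<in> ?E" for i using that by (simp add: glue_def)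
    have "restrict (glue s t) E = s" "restrict (glue s t) ?E = t"
      using s(2) t(2) gs gt by (auto simp: fun_eq_iff extensional_def restrict_def)
    then show "(restrict (case st of (s, t) \<Rightarrow> glue s t) E,
        restrict (case st of (s, t) \<Rightarrow> glue s t) ?E) = st"
      using st by simp
    have 1: "bij_betw (glue s t) E F"
      using s(1) by (subst bij_betw_cong[of E "glue s t" s, OF gs]) simp_all
    have 2: "bij_betw (glue s t) ?E ?F"
      using t(1) by (subst bij_betw_cong[of ?E "glue s t" t, OF gt]) simp_all
    have "bij_betw (glue s t) (E \<union> ?E) (F \<union> ?F)"
      by (rule bij_betw_combine[OF 1 2]) auto
    moreover have "E \<union> ?E = {1..n}" "F \<union> ?F = {1..n}" using assms by auto
    ultimately have "bij_betw (glue s t) {1..n} {1..n}" by simp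
    moreover have "glue s t i = i" if "i \<notin> {1..n}" for i
      using that assms(1) by (auto simp: glue_def)
    ultimately have "glue s t \<in> sym_grp n"
      unfolding sym_grp_def by (auto intro: bij_imp_permutes)
    moreover have "Exclp g h n (glue s t) = E"
    proof (rule set_eqI)
      fix i
      show "i \<in> Exclp g h n (glue s t) \<longleftrightarrow> i \<in> E"
        using assms(1) s(3)[of i] t(3)[of i] gs[of i] gt[of i]
        by (cases "i \<in> E") (auto simp: Exclp_thr)
    qed
    moreover have "glue s t ` E = F" using 1 by (simp add: bij_betw_def)
    ultimately show "(case st of (s, t) \<Rightarrow> glue s t) \<in> ?S" using st by simp
    have "invs E (glue s t) = invs E s" "invs ?E (glue s t) = invs ?E t"
      using gs gt by (auto intro!: invs_cong)
    then show "q ^ (invs E (case st of (s, t) \<Rightarrow> glue s t) + invs ?E (case st of (s, t) \<Rightarrow> glue s t))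
        = (case st of (s, t) \<Rightarrow> q ^ invs E s * q ^ invs ?E t)"
      using st by (simp add: power_add)
  next
    fix \<sigma> assume "\<sigma> \<in> ?S"
    then have \<sigma>: "\<sigma> permutes {1..n}" "Exclp g h n \<sigma> = E" "\<sigma> ` E = F"
      by (auto simp: sym_grp_def)
    have inj: "inj \<sigma>" using \<sigma>(1) by (rule permutes_inj)
    have "bij_betw \<sigma> E F" using \<sigma>(3) inj by (auto simp: bij_betw_def inj_on_def dest: injD)
    then have 1: "bij_betw (restrict \<sigma> E) E F" by (simp cong: bij_betw_cong)
    have "\<sigma> ` ?E = ?F"
      using \<sigma>(3) permutes_image[OF \<sigma>(1)] by (simp add: image_set_diff[OF inj])
    then have "bij_betw \<sigma> ?E ?F" using inj by (auto simp: bij_betw_def inj_on_def dest: injD)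
    then have 2: "bij_betw (restrict \<sigma> ?E) ?E ?F"
      by (subst bij_betw_cong[of ?E "restrict \<sigma> ?E" \<sigma>]) simp_all
    have 3: "i \<in> E \<longleftrightarrow> thr g h i \<le> \<sigma> i" if "i \<in> {1..n}" for i
      using \<sigma>(2) that by (auto simp: Exclp_thr)
    show "(restrict \<sigma> E, restrict \<sigma> ?E) \<in> ?A \<times> ?B"
      using 1 2 3 assms(1) by (force simp: bijs_def not_le)
    show "(case (restrict \<sigma> E, restrict \<sigma> ?E) of (s, t) \<Rightarrow> glue s t) = \<sigma>"
      using permutes_not_in[OF \<sigma>(1)] by (auto simp: glue_def fun_eq_iff)
  qed
  finally show ?thesis by simp
qed

lemma nat_diff_int: "nat (int a - int b) = a - b"
  by arith

text \<open>Outside E the greedy count involves complements of E and F; passing to E and F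
  themselves, the total sizes cancel because card E = card F, and \<open>slots\<close>
  remains.\<close>

lemma class_weight_bijs:
  fixes q :: "'a::comm_semiring_1"
  assumes "E \<subseteq> {1..n}" "F \<subseteq> {1..n}" "card E = card F" "0 < h"
  shows "(\<Sum>s\<in>bijs E F. if \<forall>i\<in>E. thr g h i \<le> s i then q ^ invs E s else 0)
      * (\<Sum>s\<in>bijs ({1..n} - E) ({1..n} - F).
          if \<forall>i\<in>{1..n} - E. s i < thr g h i then q ^ invs ({1..n} - E) s else 0)
    = class_weight q g h n E F"
proof -
  let ?E = "{1..n} - E" and ?F = "{1..n} - F"
  have fin: "finite E" "finite F" using assms finite_subset by auto
  have cards: "card ?E = card ?F"
    using assms fin by (simp add: card_Diff_subset)
  have mono: "i \<le> j \<Longrightarrow> thr g h i \<le> thr g h j" for i j by (auto simp: thr_def)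
  have in_E: "qint q (slots g h n E F i)
      = qbr q (card {v\<in>F. thr g h i \<le> v} - card {j\<in>E. i < j})" if "i \<in> E" for i
    using that by (simp add: slots_def qint_def nat_diff_int)
  have out_E: "qint q (slots g h n E F i)
      = qbr q (card {v\<in>?F. v < thr g h i} - card {j\<in>?E. j < i})" if i: "i \<in> ?E" for i
  proof -
    have a: "1 \<le> thr g h i" using assms(4) by (auto simp: thr_def)
    have split: "card {v\<in>{1..n} - S. v < b} + card {v\<in>S. v < b} = min b (Suc n) - 1"
      if "S \<subseteq> {1..n}" "1 \<le> b" for S b
    proof -
      have "finite S" using that finite_subset by blast
      then have "card {v\<in>{1..n} - S. v < b} + card {v\<in>S. v < b}
          = card ({v\<in>{1..n} - S. v < b} \<union> {v\<in>S. v < b})"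
        by (intro card_Un_disjoint[symmetric]) auto
      also have "{v\<in>{1..n} - S. v < b} \<union> {v\<in>S. v < b} = {1..<min b (Suc n)}"
        using that by auto
      finally show ?thesis by simp
    qed
    have 1: "card {v\<in>?F. v < thr g h i} + card {v\<in>F. v < thr g h i} = min (thr g h i) (Suc n) - 1"
      by (rule split[OF assms(2) a])
    have 2: "card {j\<in>?E. j < i} + card {j\<in>E. j < i} = i - 1"
      using split[OF assms(1), of i] i by simp
    have 3: "card {v\<in>F. v < thr g h i} + card {v\<in>F. thr g h i \<le> v} = card F"
      using card_filter_split[OF fin(2), of "\<lambda>v. v < thr g h i"] by (simp add: not_less)
    have "{j\<in>E. \<not> j < i} = {j\<in>E. i < j}" using i by (auto simp: not_less le_less)
    then have 4: "card {j\<in>E. j < i} + card {j\<in>E. i < j} = card E"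
      using card_filter_split[OF fin(1), of "\<lambda>j. j < i"] by simp
    have "1 \<le> i" "1 \<le> min (thr g h i) (Suc n)" using i a by auto
    then have "nat (slots g h n E F i) = card {v\<in>?F. v < thr g h i} - card {j\<in>?E. j < i}"
      using 1 2 3 4 assms(3) i unfolding slots_def by auto
    then show ?thesis by (simp add: qint_def)
  qed
  have "{1..n} = E \<union> ?E" using assms(1) by auto
  then have "class_weight q g h n E F
      = (\<Prod>i\<in>E. qint q (slots g h n E F i)) * (\<Prod>i\<in>?E. qint q (slots g h n E F i))"
    unfolding class_weight_def
    using prod.subset_diff[OF assms(1), of "\<lambda>i. qint q (slots g h n E F i)"] by (simp add: mult.commute)
  also have "\<dots> = (\<Prod>i\<in>E. qbr q (card {v\<in>F. thr g h i \<le> v} - card {j\<in>E. i < j}))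
      * (\<Prod>i\<in>?E. qbr q (card {v\<in>?F. v < thr g h i} - card {j\<in>?E. j < i}))"
    by (intro arg_cong2[of _ _ _ _ "(*)"] prod.cong refl in_E out_E)
  also have "(\<Prod>i\<in>E. qbr q (card {v\<in>F. thr g h i \<le> v} - card {j\<in>E. i < j}))
      = (\<Sum>s\<in>bijs E F. if \<forall>i\<in>E. thr g h i \<le> s i then q ^ invs E s else 0)"
    by (rule sum_bijs_above[symmetric]) (use fin assms(3) mono in auto)
  also have "(\<Prod>i\<in>?E. qbr q (card {v\<in>?F. v < thr g h i} - card {j\<in>?E. j < i}))
      = (\<Sum>s\<in>bijs ?E ?F. if \<forall>i\<in>?E. s i < thr g h i then q ^ invs ?E s else 0)"
    by (rule sum_bijs_below[symmetric]) (use cards mono in auto)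
  finally show ?thesis by simp
qed

section \<open>The generating function of (exc, den) as a sum over classes\<close>

definition classes :: "nat \<Rightarrow> nat \<Rightarrow> (nat set \<times> nat set) set" where
  "classes m n = {(E, F). E \<subseteq> {1..m} \<and> F \<subseteq> {1..n} \<and> card E = card F}"

lemma finite_classes: "finite (classes m n)"
  by (rule finite_subset[of _ "Pow {1..m} \<times> Pow {1..n}"]) (auto simp: classes_def)

definition class_term ::
    "'a::comm_semiring_1 \<Rightarrow> nat \<Rightarrow> nat \<Rightarrow> nat \<Rightarrow> nat \<Rightarrow> (nat \<Rightarrow> 'a) \<Rightarrow> nat set \<Rightarrow> nat set \<Rightarrow> 'a" where
  "class_term q g l h n w E F =
    w (card {i\<in>E. l \<le> i}) * q ^ (\<Sum>i\<in>E. i + g - 1) * class_weight q g h n E F"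

lemma sum_exc_den_classes:
  fixes q :: "'a::comm_semiring_1"
  assumes "0 < h" "h \<le> g + l"
  shows "(\<Sum>\<sigma>\<in>sym_grp n. w (exc g l n \<sigma>) * q ^ den g h n \<sigma>)
    = (\<Sum>(E, F)\<in>classes n n. class_term q g l h n w E F)"
proof -
  let ?c = "\<lambda>\<sigma>. (Exclp g h n \<sigma>, \<sigma> ` Exclp g h n \<sigma>)"
  let ?f = "\<lambda>\<sigma>. w (exc g l n \<sigma>) * q ^ den g h n \<sigma>"
  have sub: "?c ` sym_grp n \<subseteq> classes n n"
  proof (rule image_subsetI)
    fix \<sigma> assume "\<sigma> \<in> sym_grp n"
    then have \<sigma>: "\<sigma> permutes {1..n}" by (simp add: sym_grp_def)
    have "Exclp g h n \<sigma> \<subseteq> {1..n}" by (auto simp: Exclp_def)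
    moreover have "\<sigma> ` Exclp g h n \<sigma> \<subseteq> {1..n}"
      using calculation permutes_image[OF \<sigma>] by blast
    moreover have "card (Exclp g h n \<sigma>) = card (\<sigma> ` Exclp g h n \<sigma>)"
      using permutes_inj_on[OF \<sigma>] by (simp add: card_image)
    ultimately show "?c \<sigma> \<in> classes n n" by (simp add: classes_def)
  qed
  have "(\<Sum>\<sigma>\<in>sym_grp n. ?f \<sigma>) = (\<Sum>x\<in>classes n n. \<Sum>\<sigma>\<in>{\<sigma>\<in>sym_grp n. ?c \<sigma> = x}. ?f \<sigma>)"
    by (rule sum.group[OF finite_sym_grp finite_classes sub, symmetric])
  also have "\<dots> = (\<Sum>(E, F)\<in>classes n n. class_term q g l h n w E F)"
  proof (rule sum.cong[OF refl])
    fix x assume "x \<in> classes n n"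
    then obtain E F where x: "x = (E, F)" "E \<subseteq> {1..n}" "F \<subseteq> {1..n}" "card E = card F"
      by (auto simp: classes_def)
    have eq: "{\<sigma>\<in>sym_grp n. ?c \<sigma> = x} = {\<sigma>\<in>sym_grp n. Exclp g h n \<sigma> = E \<and> \<sigma> ` E = F}"
      using x(1) by auto
    have "(\<Sum>\<sigma>\<in>{\<sigma>\<in>sym_grp n. ?c \<sigma> = x}. ?f \<sigma>)
        = (\<Sum>\<sigma>\<in>{\<sigma>\<in>sym_grp n. Exclp g h n \<sigma> = E \<and> \<sigma> ` E = F}.
            w (card {i\<in>E. l \<le> i}) * q ^ (\<Sum>i\<in>E. i + g - 1) * q ^ (invs E \<sigma> + invs ({1..n} - E) \<sigma>))"
      unfolding eq by (intro sum.cong) (auto simp: exc_alt[OF assms(2)] den_alt power_add mult_ac)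
    also have "\<dots> = class_term q g l h n w E F"
      unfolding class_term_def class_weight_bijs[OF x(2-4) assms(1), symmetric]
        sum_class[OF x(2,3), symmetric] by (simp add: sum_distrib_left)
    finally show "(\<Sum>\<sigma>\<in>{\<sigma>\<in>sym_grp n. ?c \<sigma> = x}. ?f \<sigma>)
        = (case x of (E, F) \<Rightarrow> class_term q g l h n w E F)" using x(1) by simp
  qed
  finally show ?thesis .
qed

section \<open>The common recursion\<close>

lemma class_weight_eq_0:
  assumes "i \<in> E" "i \<in> {1..n}" "F \<subseteq> {1..n}" "n < thr g h i"
  shows "class_weight q g h n E F = 0"
proof -
  have "{v\<in>F. thr g h i \<le> v} = {}" using assms by auto
  then have "card {v\<in>F. thr g h i \<le> v} = 0" by (simp only: card.empty)
  then have "slots g h n E F i \<le> 0" using assms(1) by (simp add: slots_def)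
  then have "qint q (slots g h n E F i) = 0" by (rule qint_nonpos)
  then show ?thesis unfolding class_weight_def using assms(2) by (intro prod_zero) auto
qed

text \<open>No position beyond n - g can be an excedance. Applied with n = m + g and n = m + g - 1
  and the same \<open>m\<close>, this gives both sizes of the recursion a common range of
  positions.\<close>

lemma sum_classes_restrict:
  assumes "n \<le> m + g" "m \<le> n"
  shows "(\<Sum>(E, F)\<in>classes n n. class_term q g l h n w E F)
    = (\<Sum>(E, F)\<in>classes m n. class_term q g l h n w E F)"
proof (rule sum.mono_neutral_right[OF finite_classes])
  show "classes m n \<subseteq> classes n n" using assms(2) by (auto simp: classes_def)
  show "\<forall>x\<in>classes n n - classes m n. (case x of (E, F) \<Rightarrow> class_term q g l h n w E F) = 0"
  proof (rule ballI)
    fix x assume "x \<in> classes n n - classes m n"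
    then obtain E F where x: "x = (E, F)" "E \<subseteq> {1..n}" "F \<subseteq> {1..n}" "\<not> E \<subseteq> {1..m}"
      by (auto simp: classes_def)
    obtain i where i: "i \<in> E" "i \<notin> {1..m}" using x(4) by (meson subsetI)
    then have "i \<in> {1..n}" "n < thr g h i" using x(2) assms(1) by (auto simp: thr_def)
    then have "class_weight q g h n E F = 0" using i x(3) by (intro class_weight_eq_0)
    then show "(case x of (E, F) \<Rightarrow> class_term q g l h n w E F) = 0"
      using x(1) by (simp add: class_term_def)
  qed
qed

text \<open>The recursion in transposed form: a weight on the first statistic in size n + 1 is
  pulled back to size n, with \<open>c\<close> running over the increments of the second
  statistic.\<close>

definition recursion_weight ::
    "'a::comm_semiring_1 \<Rightarrow> nat \<Rightarrow> nat \<Rightarrow> (nat \<Rightarrow> 'a) \<Rightarrow> nat \<Rightarrow> 'a" where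
  "recursion_weight q r n w k = (\<Sum>c<Suc n. w (if c < k + r then k else Suc k) * q ^ c)"

lemma sum_corank_above_Icc:
  fixes E :: "nat set" and \<phi> :: "nat \<Rightarrow> 'b::comm_monoid_add"
  assumes "E \<subseteq> {1..m}"
  shows "(\<Sum>x\<in>{1..m} - E. \<phi> (x - 1 + card {j\<in>E. x < j})) = (\<Sum>c\<in>{card E..<m}. \<phi> c)"
proof -
  define A where "A = {p. Suc p \<in> E}"
  have E: "E = Suc ` A"
  proof (rule set_eqI)
    fix x show "x \<in> E \<longleftrightarrow> x \<in> Suc ` A"
      using assms by (cases x) (auto simp: A_def)
  qed
  have "{j\<in>E. Suc p < j} = Suc ` {a\<in>A. p < a}" for p unfolding E by auto
  then have card: "card {j\<in>E. Suc p < j} = card {a\<in>A. p < a}" for p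
    by (simp add: card_image)
  have "(\<Sum>x\<in>{1..m} - E. \<phi> (x - 1 + card {j\<in>E. x < j}))
      = (\<Sum>p\<in>{..<m} - A. \<phi> (p + card {a\<in>A. p < a}))"
  proof (rule sum.reindex_bij_witness[of _ Suc "\<lambda>x. x - 1"])
    fix x assume x: "x \<in> {1..m} - E"
    then show "Suc (x - 1) = x" "x - 1 \<in> {..<m} - A" by (auto simp: A_def)
    show "\<phi> (x - 1 + card {a\<in>A. x - 1 < a}) = \<phi> (x - 1 + card {j\<in>E. x < j})"
      using x card[of "x - 1"] by simp
  qed (auto simp: A_def)
  also have "\<dots> = (\<Sum>c\<in>{card A..<m}. \<phi> c)"
    using assms by (intro sum_corank_above) (auto simp: A_def)
  also have "card A = card E" unfolding E by (simp add: card_image)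
  finally show ?thesis .
qed

text \<open>The increments go to three moves: N + 1 as a non-excedance takes the first
  \<open>g\<close>, putting N + 1 in place of an excedance value takes the next card F, and creating
  an excedance position with value N + 1 takes the others.\<close>

lemma recursion_weight_split:
  fixes q :: "'a::comm_semiring_1"
  assumes n: "Suc N = m + g" and g: "1 \<le> g" and l: "1 \<le> l"
    and E: "E \<subseteq> {1..m}" and F: "F \<subseteq> {1..N}" and card: "card E = card F"
  defines "k \<equiv> card {i\<in>E. l \<le> i}"
  shows "recursion_weight q (g + l - 1) N w k = w k * qint q (int g)
    + (\<Sum>e\<in>F. w k * q ^ (g + card {v\<in>F. e < v}))
    + (\<Sum>x\<in>{1..m} - E. w (card {i\<in>insert x E. l \<le> i}) * q ^ (x + g - 1 + card {j\<in>E. x < j}))"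
proof -
  let ?r = "g + l - 1"
  let ?\<psi> = "\<lambda>c. w (if c < k + ?r then k else Suc k) * q ^ c"
  have finE: "finite E" and finF: "finite F" using E F finite_subset by auto
  have "card {j\<in>E. \<not> l \<le> j} \<le> card {1..<l}" using E by (intro card_mono) auto
  \<comment> \<open>Consequently all increments below g + card E lie below the cutoff k + r and keep
    k.\<close>
  then have Kk: "card E \<le> k + (l - 1)"
    using card_filter_split[OF finE, of "\<lambda>i. l \<le> i"] by (simp add: k_def)
  have Km: "card E \<le> m" using card_mono[OF _ E] by simp
  have "(\<Sum>c<Suc N. ?\<psi> c) = (\<Sum>c\<in>{g..<Suc N}. ?\<psi> c) + (\<Sum>c<g. ?\<psi> c)"
    using n by (intro sum_lessThan_split) simp
  also have "(\<Sum>c<g. ?\<psi> c) = w k * qint q (int g)"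
    unfolding qint_def qbr_def nat_int sum_distrib_left using l g by (intro sum.cong) auto
  also have "(\<Sum>c\<in>{g..<Suc N}. ?\<psi> c) = (\<Sum>c<m. ?\<psi> (g + c))"
    by (rule sum.reindex_bij_witness[of _ "\<lambda>c. g + c" "\<lambda>c. c - g"]) (use n in auto)
  also have "\<dots> = (\<Sum>c\<in>{card E..<m}. ?\<psi> (g + c)) + (\<Sum>c<card E. ?\<psi> (g + c))"
    by (rule sum_lessThan_split[OF Km])
  also have "(\<Sum>c<card E. ?\<psi> (g + c)) = (\<Sum>c<card F. w k * q ^ (g + c))"
    unfolding card using Kk g l card by (intro sum.cong) auto
  also have "\<dots> = (\<Sum>e\<in>F. w k * q ^ (g + card {v\<in>F. e < v}))"
    by (rule sum_rank_above[OF finF, where \<phi> = "\<lambda>c. w k * q ^ (g + c)", symmetric])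
  also have "(\<Sum>c\<in>{card E..<m}. ?\<psi> (g + c))
      = (\<Sum>x\<in>{1..m} - E. ?\<psi> (g + (x - 1 + card {j\<in>E. x < j})))"
    by (rule sum_corank_above_Icc[OF E, where \<phi> = "\<lambda>c. ?\<psi> (g + c)", symmetric])
  also have "\<dots> = (\<Sum>x\<in>{1..m} - E. w (card {i\<in>insert x E. l \<le> i}) * q ^ (x + g - 1 + card {j\<in>E. x < j}))"
  proof (rule sum.cong[OF refl])
    fix x assume x: "x \<in> {1..m} - E"
    have c: "g + (x - 1 + card {j\<in>E. x < j}) = x + g - 1 + card {j\<in>E. x < j}"
      using x by auto
    have kx: "card {i\<in>insert x E. l \<le> i} = k + (if l \<le> x then 1 else 0)"
      using card_insert_filter[OF finE, of x] x by (simp add: k_def)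
    \<comment> \<open>The cutoff has to agree with whether \<open>exc\<close> counts the new
      position. The set of counted positions and the set of those right of \<open>x\<close> differ
      only by positions between \<open>l\<close> and \<open>x\<close>, which bounds the difference
      of their sizes.\<close>
    have "x + card {j\<in>E. x < j} < k + l \<longleftrightarrow> x < l"
    proof (cases "l \<le> x")
      case True
      have "{i\<in>E. l \<le> i} \<subseteq> {j\<in>E. x < j} \<union> {l..<x}" using x by (auto simp: not_less le_less)
      then have "k \<le> card ({j\<in>E. x < j} \<union> {l..<x})"
        unfolding k_def using finE by (intro card_mono) auto
      also have "\<dots> \<le> card {j\<in>E. x < j} + card {l..<x}" by (rule card_Un_le)
      finally show ?thesis using True by auto
    next
      case False
      then have "{j\<in>E. x < j} \<subseteq> {i\<in>E. l \<le> i} \<union> {Suc x..<l}" by auto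
      then have "card {j\<in>E. x < j} \<le> card ({i\<in>E. l \<le> i} \<union> {Suc x..<l})"
        using finE by (intro card_mono) auto
      also have "\<dots> \<le> k + card {Suc x..<l}" unfolding k_def by (rule card_Un_le)
      finally show ?thesis using False by auto
    qed
    then have "x + g - 1 + card {j\<in>E. x < j} < k + ?r \<longleftrightarrow> x < l" using g l x by auto
    then show "?\<psi> (g + (x - 1 + card {j\<in>E. x < j}))
        = w (card {i\<in>insert x E. l \<le> i}) * q ^ (x + g - 1 + card {j\<in>E. x < j})"
      unfolding c kx by (cases "l \<le> x") auto
  qed
  finally show ?thesis by (simp add: recursion_weight_def ac_simps)
qed

text \<open>Positions up to \<open>m\<close> have thresholds at most N + 1, so an N + 1 that is no
  excedance value must stand in one of the last \<open>g\<close> positions. Only the tail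
  grows.\<close>

lemma class_weight_Suc:
  assumes n: "Suc N = m + g" and g: "1 \<le> g" and h: "h \<le> Suc N"
    and E: "E \<subseteq> {1..m}" and F: "F \<subseteq> {1..N}"
  shows "class_weight q g h (Suc N) E F = qint q (int g) * class_weight q g h N E F"
proof -
  have "slots g h (Suc N) E F i = slots g h N E F i" if "i \<in> {1..m}" for i
  proof -
    have "thr g h i \<le> Suc N" using that n h by (auto simp: thr_def)
    then show ?thesis by (simp add: slots_def min_def)
  qed
  then have eq: "(\<Prod>i\<in>{1..m}. qint q (slots g h (Suc N) E F i)) = (\<Prod>i\<in>{1..m}. qint q (slots g h N E F i))"
    by simp
  have F': "F \<subseteq> {1..Suc N}" using F by auto
  have "{1..Suc N - m} = insert g {1..N - m}" "g \<notin> {1..N - m}" using n g by auto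
  then have "(\<Prod>i\<in>{1..Suc N - m}. qint q (int i)) = qint q (int g) * (\<Prod>i\<in>{1..N - m}. qint q (int i))"
    by (simp only:) (rule prod.insert; simp)
  moreover have "class_weight q g h (Suc N) E F
      = (\<Prod>i\<in>{1..m}. qint q (slots g h N E F i)) * (\<Prod>i\<in>{1..Suc N - m}. qint q (int i))"
    using class_weight_split[OF E F', of g q h] eq n by simp
  moreover have "class_weight q g h N E F
      = (\<Prod>i\<in>{1..m}. qint q (slots g h N E F i)) * (\<Prod>i\<in>{1..N - m}. qint q (int i))"
    using class_weight_split[OF E F, of g q h] n g by simp
  ultimately show ?thesis by (simp add: mult_ac)
qed

lemma sum_classes_Suc_large:
  fixes q :: "'a::comm_semiring_1"
  assumes n: "Suc N = m + g" and g: "1 \<le> g" and l: "1 \<le> l" and h: "g < h" "h \<le> Suc N"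
  shows "(\<Sum>(E, F)\<in>classes (Suc N) (Suc N). class_term q g l h (Suc N) w E F)
    = (\<Sum>(E, F)\<in>classes N N. class_term q g l h N (recursion_weight q (g + l - 1) N w) E F)"
proof -
  let ?W = "class_weight q g h" and ?s = "\<lambda>E. \<Sum>i\<in>E. i + g - 1" and ?k = "\<lambda>E. card {i\<in>E. l \<le> i}"
  define C where "C = classes m N"
  \<comment> \<open>These are the classes of size N + 1 whose excedance value N + 1 has been struck
    out, hence one more position than values.\<close>
  define D where "D = {(E, F). E \<subseteq> {1..m} \<and> F \<subseteq> {1..N} \<and> card E = Suc (card F)}"
  have finC: "finite C" by (simp add: C_def finite_classes)
  have finD: "finite D"
    by (rule finite_subset[of _ "Pow {1..m} \<times> Pow {1..N}"]) (auto simp: D_def)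
  have C: "E \<subseteq> {1..m}" "F \<subseteq> {1..N}" "card E = card F" "finite E" "finite F" if "(E, F) \<in> C" for E F
    using that by (auto simp: C_def classes_def intro: finite_subset)
  have D: "E \<subseteq> {1..m}" "F \<subseteq> {1..N}" "card E = Suc (card F)" "finite E" "finite F" if "(E, F) \<in> D" for E F
    using that by (auto simp: D_def intro: finite_subset)
  have mN: "m \<le> N" using n g by simp

  have S1: "(\<Sum>(E, F)\<in>C. class_term q g l h (Suc N) w E F)
      = (\<Sum>(E, F)\<in>C. w (?k E) * qint q (int g) * q ^ ?s E * ?W N E F)"
  proof (rule sum.cong[OF refl], clarify)
    fix E F assume EF: "(E, F) \<in> C"
    show "class_term q g l h (Suc N) w E F = w (?k E) * qint q (int g) * q ^ ?s E * ?W N E F"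
      by (simp only: class_term_def class_weight_Suc[OF n g h(2) C(1,2)[OF EF]] mult_ac)
  qed

  have S2: "(\<Sum>(E, F)\<in>C. \<Sum>e\<in>F. w (?k E) * q ^ (g + card {v\<in>F. e < v}) * q ^ ?s E * ?W N E F)
      = (\<Sum>(E, F)\<in>D. \<Sum>v\<in>{1..N} - F.
          w (?k E) * q ^ ?s E * (q ^ (g + card {u\<in>F. v < u}) * ?W N E (insert v F)))"
    (is "?L = ?R")
  proof -
    let ?i = "\<lambda>((E, F), v). ((E, insert v F), v)" and ?j = "\<lambda>((E, F), e). ((E, F - {e}), e)"
    let ?f = "\<lambda>((E, F), e). w (?k E) * q ^ (g + card {v\<in>F. e < v}) * q ^ ?s E * ?W N E F"
    let ?f' = "\<lambda>((E, F), v). w (?k E) * q ^ ?s E * (q ^ (g + card {u\<in>F. v < u}) * ?W N E (insert v F))"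
    have "?L = (\<Sum>x\<in>(SIGMA (E, F):C. F). ?f x)"
      using finC C(5) by (subst sum.Sigma[symmetric]) (auto simp: case_prod_unfold)
    also have "\<dots> = (\<Sum>x\<in>(SIGMA (E, F):D. {1..N} - F). ?f' x)"
    proof (rule sum.reindex_bij_witness[of _ ?i ?j])
      fix x assume "x \<in> (SIGMA (E, F):C. F)"
      then obtain E F e where x: "x = ((E, F), e)" "(E, F) \<in> C" "e \<in> F" by auto
      have eq: "{v\<in>F. e < v} = {v\<in>F - {e}. e < v}" by auto
      have ins: "insert e (F - {e}) = F" using x(3) by auto
      show "?i (?j x) = x" unfolding x(1) prod.case ins ..
      show "?f' (?j x) = ?f x" unfolding x(1) prod.case ins eq by (simp only: mult_ac)
      have "card F = Suc (card (F - {e}))"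
        using x(3) C(5)[OF x(2)] by (metis card_Suc_Diff1)
      then show "?j x \<in> (SIGMA (E, F):D. {1..N} - F)"
        using x C(1-3)[OF x(2)] by (auto simp: D_def)
    next
      fix x assume "x \<in> (SIGMA (E, F):D. {1..N} - F)"
      then obtain E F v where x: "x = ((E, F), v)" "(E, F) \<in> D" "v \<in> {1..N}" "v \<notin> F" by auto
      then show "?j (?i x) = x" by simp
      show "?i x \<in> (SIGMA (E, F):C. F)"
        using x D[OF x(2)] by (auto simp: C_def classes_def)
    qed
    also have "\<dots> = ?R"
      using finD by (subst sum.Sigma[symmetric]) (auto simp: case_prod_unfold)
    finally show ?thesis .
  qed

  \<comment> \<open>The same with positions; the factor with exponent x + g - 1 is absorbed by the
    position sum of the enlarged E.\<close>
  have S3: "(\<Sum>(E, F)\<in>C. \<Sum>x\<in>{1..m} - E.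
        w (?k (insert x E)) * q ^ (x + g - 1 + card {j\<in>E. x < j}) * q ^ ?s E * ?W N E F)
      = (\<Sum>(E, F)\<in>D. \<Sum>x\<in>E. w (?k E) * q ^ ?s E * (q ^ card {j\<in>E. x < j} * ?W N (E - {x}) F))"
    (is "?L = ?R")
  proof -
    let ?i = "\<lambda>((E, F), x). ((E - {x}, F), x)" and ?j = "\<lambda>((E, F), x). ((insert x E, F), x)"
    let ?f = "\<lambda>((E, F), x). w (?k (insert x E)) * q ^ (x + g - 1 + card {j\<in>E. x < j}) * q ^ ?s E * ?W N E F"
    let ?f' = "\<lambda>((E, F), x). w (?k E) * q ^ ?s E * (q ^ card {j\<in>E. x < j} * ?W N (E - {x}) F)"
    have "?L = (\<Sum>y\<in>(SIGMA (E, F):C. {1..m} - E). ?f y)"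
      using finC by (subst sum.Sigma[symmetric]) (auto simp: case_prod_unfold)
    also have "\<dots> = (\<Sum>y\<in>(SIGMA (E, F):D. E). ?f' y)"
    proof (rule sum.reindex_bij_witness[of _ ?i ?j])
      fix y assume "y \<in> (SIGMA (E, F):C. {1..m} - E)"
      then obtain E F x where y: "y = ((E, F), x)" "(E, F) \<in> C" "x \<in> {1..m}" "x \<notin> E" by auto
      have eq: "{j\<in>insert x E. x < j} = {j\<in>E. x < j}" by auto
      have s: "?s (insert x E) = x + g - 1 + ?s E" using y(4) C(4)[OF y(2)] by simp
      have del: "insert x E - {x} = E" using y(4) by auto
      show "?i (?j y) = y" unfolding y(1) prod.case del ..
      show "?f' (?j y) = ?f y" unfolding y(1) prod.case del eq s by (simp only: power_add mult_ac)
      show "?j y \<in> (SIGMA (E, F):D. E)"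
        using y C[OF y(2)] by (auto simp: D_def)
    next
      fix y assume "y \<in> (SIGMA (E, F):D. E)"
      then obtain E F x where y: "y = ((E, F), x)" "(E, F) \<in> D" "x \<in> E" by auto
      have "card E = Suc (card (E - {x}))"
        using y(3) D(4)[OF y(2)] by (metis card_Suc_Diff1)
      then show "?i y \<in> (SIGMA (E, F):C. {1..m} - E)"
        using y D(1-3)[OF y(2)] by (auto simp: C_def classes_def)
      show "?j (?i y) = y"
        using y by auto
    qed
    also have "\<dots> = ?R"
      using finD D(4) by (subst sum.Sigma[symmetric]) (auto simp: case_prod_unfold)
    finally show ?thesis .
  qed

  have S4: "(\<Sum>(E, F)\<in>(\<lambda>(E, F). (E, insert (Suc N) F)) ` D. class_term q g l h (Suc N) w E F)
      = (\<Sum>(E, F)\<in>D. (\<Sum>v\<in>{1..N} - F.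
          w (?k E) * q ^ ?s E * (q ^ (g + card {u\<in>F. v < u}) * ?W N E (insert v F)))
        + (\<Sum>x\<in>E. w (?k E) * q ^ ?s E * (q ^ card {j\<in>E. x < j} * ?W N (E - {x}) F)))"
  proof -
    have notin: "Suc N \<notin> F" if "(E, F) \<in> D" for E F using D(2)[OF that] by auto
    have "inj_on (\<lambda>(E, F). (E, insert (Suc N) F)) D"
    proof (rule inj_onI)
      fix x y assume xy: "x \<in> D" "y \<in> D"
        "(case x of (E, F) \<Rightarrow> (E, insert (Suc N) F)) = (case y of (E, F) \<Rightarrow> (E, insert (Suc N) F))"
      obtain E F E' F' where "x = (E, F)" "y = (E', F')" by force
      then show "x = y" using xy notin[of E F] notin[of E' F'] by (auto simp: insert_ident)
    qed
    then have "(\<Sum>(E, F)\<in>(\<lambda>(E, F). (E, insert (Suc N) F)) ` D. class_term q g l h (Suc N) w E F)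
        = (\<Sum>(E, F)\<in>D. class_term q g l h (Suc N) w E (insert (Suc N) F))"
      by (simp add: sum.reindex case_prod_unfold comp_def)
    also have "\<dots> = (\<Sum>(E, F)\<in>D. (\<Sum>v\<in>{1..N} - F.
          w (?k E) * q ^ ?s E * (q ^ (g + card {u\<in>F. v < u}) * ?W N E (insert v F)))
        + (\<Sum>x\<in>E. w (?k E) * q ^ ?s E * (q ^ card {j\<in>E. x < j} * ?W N (E - {x}) F)))"
    proof (rule sum.cong[OF refl], clarify)
      fix E F assume EF: "(E, F) \<in> D"
      show "class_term q g l h (Suc N) w E (insert (Suc N) F) = (\<Sum>v\<in>{1..N} - F.
          w (?k E) * q ^ ?s E * (q ^ (g + card {u\<in>F. v < u}) * ?W N E (insert v F)))
        + (\<Sum>x\<in>E. w (?k E) * q ^ ?s E * (q ^ card {j\<in>E. x < j} * ?W N (E - {x}) F))"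
        unfolding class_term_def class_weight_insert_max[OF n g h D(1-3)[OF EF]]
        by (simp only: distrib_left sum_distrib_left)
    qed
    finally show ?thesis .
  qed

  have split: "classes m (Suc N) = C \<union> (\<lambda>(E, F). (E, insert (Suc N) F)) ` D"
  proof (rule equalityI)
    show "classes m (Suc N) \<subseteq> C \<union> (\<lambda>(E, F). (E, insert (Suc N) F)) ` D"
    proof (rule subsetI)
      fix x assume "x \<in> classes m (Suc N)"
      then obtain E F where x: "x = (E, F)" "E \<subseteq> {1..m}" "F \<subseteq> {1..Suc N}" "card E = card F"
        by (auto simp: classes_def)
      show "x \<in> C \<union> (\<lambda>(E, F). (E, insert (Suc N) F)) ` D"
      proof (cases "Suc N \<in> F")
        case True
        have "finite F" using x(3) finite_subset by blast
        then have "card F = Suc (card (F - {Suc N}))" using True by (metis card_Suc_Diff1)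
        moreover have "F - {Suc N} \<subseteq> {1..N}" using x(3) by (auto simp: le_Suc_eq)
        ultimately have "(E, F - {Suc N}) \<in> D" using x by (simp add: D_def)
        moreover have "x = (case (E, F - {Suc N}) of (E, F) \<Rightarrow> (E, insert (Suc N) F))"
          using True x(1) by auto
        ultimately show ?thesis by blast
      next
        case False
        then have "F \<subseteq> {1..N}" using x(3) by (force simp: le_Suc_eq)
        then show ?thesis using x by (simp add: C_def classes_def)
      qed
    qed
    show "C \<union> (\<lambda>(E, F). (E, insert (Suc N) F)) ` D \<subseteq> classes m (Suc N)"
    proof (rule Un_least)
      show "C \<subseteq> classes m (Suc N)" by (auto simp: C_def classes_def)
      show "(\<lambda>(E, F). (E, insert (Suc N) F)) ` D \<subseteq> classes m (Suc N)"
      proof (rule image_subsetI)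
        fix x assume "x \<in> D"
        moreover obtain E F where x: "x = (E, F)" by force
        ultimately have EF: "(E, F) \<in> D" by simp
        have "Suc N \<notin> F" using D(2)[OF EF] by auto
        then have "card (insert (Suc N) F) = card E" using D[OF EF] by simp
        then show "(case x of (E, F) \<Rightarrow> (E, insert (Suc N) F)) \<in> classes m (Suc N)"
          using x D(1,2)[OF EF] by (auto simp: classes_def)
      qed
    qed
  qed
  have disj: "C \<inter> (\<lambda>(E, F). (E, insert (Suc N) F)) ` D = {}" using C(2) by fastforce

  have "(\<Sum>(E, F)\<in>classes (Suc N) (Suc N). class_term q g l h (Suc N) w E F)
      = (\<Sum>(E, F)\<in>classes m (Suc N). class_term q g l h (Suc N) w E F)"
    using n mN by (intro sum_classes_restrict) auto
  also have "\<dots> = (\<Sum>(E, F)\<in>C. class_term q g l h (Suc N) w E F)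
      + (\<Sum>(E, F)\<in>(\<lambda>(E, F). (E, insert (Suc N) F)) ` D. class_term q g l h (Suc N) w E F)"
    unfolding split using finC finD disj by (intro sum.union_disjoint) auto
  also have "\<dots> = (\<Sum>(E, F)\<in>C. w (?k E) * qint q (int g) * q ^ ?s E * ?W N E F)
      + ((\<Sum>(E, F)\<in>C. \<Sum>e\<in>F. w (?k E) * q ^ (g + card {v\<in>F. e < v}) * q ^ ?s E * ?W N E F)
        + (\<Sum>(E, F)\<in>C. \<Sum>x\<in>{1..m} - E.
            w (?k (insert x E)) * q ^ (x + g - 1 + card {j\<in>E. x < j}) * q ^ ?s E * ?W N E F))"
    unfolding S1 S4 S2 S3 by (simp add: case_prod_unfold sum.distrib)
  also have "\<dots> = (\<Sum>(E, F)\<in>C. class_term q g l h N (recursion_weight q (g + l - 1) N w) E F)"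
    unfolding sum.distrib[symmetric]
  proof (rule sum.cong[OF refl], clarify)
    fix E F assume EF: "(E, F) \<in> C"
    show "w (?k E) * qint q (int g) * q ^ ?s E * ?W N E F
      + ((\<Sum>e\<in>F. w (?k E) * q ^ (g + card {v\<in>F. e < v}) * q ^ ?s E * ?W N E F)
        + (\<Sum>x\<in>{1..m} - E.
            w (?k (insert x E)) * q ^ (x + g - 1 + card {j\<in>E. x < j}) * q ^ ?s E * ?W N E F))
      = class_term q g l h N (recursion_weight q (g + l - 1) N w) E F"
      unfolding class_term_def recursion_weight_split[OF n g l C(1-3)[OF EF]]
      by (simp only: distrib_right sum_distrib_right add.assoc)
  qed
  also have "\<dots> = (\<Sum>(E, F)\<in>classes N N. class_term q g l h N (recursion_weight q (g + l - 1) N w) E F)"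
    unfolding C_def using n mN by (intro sum_classes_restrict[symmetric]) auto
  finally show ?thesis .
qed

text \<open>No letter reaches \<open>h\<close>, so only the empty class survives, and its weight is
  the full q-factorial.\<close>

lemma sum_classes_small:
  fixes q :: "'a::comm_semiring_1"
  assumes "n < h"
  shows "(\<Sum>(E, F)\<in>classes n n. class_term q g l h n w E F) = w 0 * (\<Prod>i\<in>{1..n}. qint q (int i))"
proof -
  have "(\<Sum>(E, F)\<in>classes n n. class_term q g l h n w E F)
      = (\<Sum>(E, F)\<in>{({}, {})}. class_term q g l h n w E F)"
  proof (rule sum.mono_neutral_right[OF finite_classes])
    show "{({}, {})} \<subseteq> classes n n" by (auto simp: classes_def)
    show "\<forall>x\<in>classes n n - {({}, {})}. (case x of (E, F) \<Rightarrow> class_term q g l h n w E F) = 0"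
    proof (rule ballI)
      fix x assume "x \<in> classes n n - {({}, {})}"
      then obtain E F where x: "x = (E, F)" "E \<subseteq> {1..n}" "F \<subseteq> {1..n}" "card E = card F"
        "E \<noteq> {} \<or> F \<noteq> {}" by (auto simp: classes_def)
      have "finite E" "finite F" using x finite_subset by blast+
      then have "E \<noteq> {}" using x(4,5) by auto
      then obtain i where "i \<in> E" by auto
      then have "class_weight q g h n E F = 0"
        using x assms by (intro class_weight_eq_0[of i]) (auto simp: thr_def)
      then show "(case x of (E, F) \<Rightarrow> class_term q g l h n w E F) = 0"
        using x(1) by (simp add: class_term_def)
    qed
  qed
  also have "\<dots> = w 0 * (\<Prod>i\<in>{1..n}. qint q (int (Suc n) - int i))"
  proof -
    have "slots g h n {} {} i = int (Suc n) - int i" for i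
      using assms by (simp add: slots_def thr_def min_def)
    then show ?thesis by (simp add: class_term_def class_weight_def)
  qed
  also have "(\<Prod>i\<in>{1..n}. qint q (int (Suc n) - int i)) = (\<Prod>i\<in>{1..n}. qint q (int i))"
    by (rule prod.reindex_bij_witness[of _ "\<lambda>i. Suc n - i" "\<lambda>i. Suc n - i"]) (auto simp: of_nat_diff)
  finally show ?thesis .
qed

section \<open>Comparison of the two recursions\<close>

lemma sum_exc_den_Suc:
  fixes q :: "'a::comm_semiring_1"
  assumes "1 \<le> g" "1 \<le> l" "h \<le> g + l"
  shows "(\<Sum>\<sigma>\<in>sym_grp (Suc n). w (exc g l (Suc n) \<sigma>) * q ^ den g h (Suc n) \<sigma>)
    = (\<Sum>\<tau>\<in>sym_grp n. recursion_weight q (g + l - 1) n w (exc g l n \<tau>) * q ^ den g h n \<tau>)"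
proof -
  \<comment> \<open>Excedance values exceed \<^term>\<open>g\<close>, hence raising \<^term>\<open>h\<close> to \<^term>\<open>Suc g\<close> changes nothing.\<close>
  define h' where "h' = max h (Suc g)"
  have h': "g < h'" "h' \<le> g + l" "0 < h'" using assms by (auto simp: h'_def)
  have "(\<Sum>(E, F)\<in>classes (Suc n) (Suc n). class_term q g l h' (Suc n) w E F)
    = (\<Sum>(E, F)\<in>classes n n. class_term q g l h' n (recursion_weight q (g + l - 1) n w) E F)"
  proof (cases "h' \<le> Suc n")
    case True
    then have "Suc n = (Suc n - g) + g" using h' by simp
    from sum_classes_Suc_large[OF this assms(1,2) h'(1) True] show ?thesis .
  next
    case False
    \<comment> \<open>Here n + 1 < h' \<le> g + l, so every increment is below r and the first
      statistic stays 0.\<close>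
    have "recursion_weight q (g + l - 1) n w 0 = (\<Sum>c<Suc n. w 0 * q ^ c)"
      unfolding recursion_weight_def using False h' by (intro sum.cong) auto
    then have "recursion_weight q (g + l - 1) n w 0 = w 0 * qint q (int (Suc n))"
      by (simp only: sum_distrib_left[symmetric] qint_def qbr_def nat_int)
    then show ?thesis
      using False by (simp add: sum_classes_small mult_ac del: of_nat_Suc)
  qed
  then show ?thesis
    unfolding sum_exc_den_classes[OF h'(3,2), symmetric] unfolding h'_def den_max .
qed

text \<open>The induction hypothesis is applied to the pulled-back weight, which is why
  \<open>w\<close> is arbitrary and not a power of a fixed element.\<close>

lemma equidistribution:
  fixes q :: "'a::comm_semiring_1"
  assumes "1 \<le> g" "1 \<le> l" "h \<le> g + l"
  shows "(\<Sum>\<sigma>\<in>sym_grp n. w (exc g l n \<sigma>) * q ^ den g h n \<sigma>)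
    = (\<Sum>\<sigma>\<in>sym_grp n. w (rdes (g + l - 1) n \<sigma>) * q ^ rmaj (g + l - 1) n \<sigma>)"
proof (induction n arbitrary: w)
  case 0
  have "sym_grp 0 = {id}" by (simp add: sym_grp_def)
  moreover have "exc g l 0 \<sigma> = 0" "rdes (g + l - 1) 0 \<sigma> = 0" "rmaj (g + l - 1) 0 \<sigma> = 0"
    "den g h 0 \<sigma> = 0" for \<sigma>
    by (simp_all add: exc_def rdes_def rDes_def rmaj_def den_alt Exclp_def invs_def)
  ultimately show ?case by simp
next
  case (Suc n)
  have "1 \<le> g + l - 1" using assms by simp
  note rmaj_Suc = sum_rdes_rmaj_Suc[OF this, of w n q, folded recursion_weight_def]
  show ?case
    unfolding sum_exc_den_Suc[OF assms] rmaj_Suc by (rule Suc.IH)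
qed

text \<open>Passage from weighted sums to counts: the indicator weight selects the first statistic
  and the indeterminate records the second.\<close>

lemma coeff_indicator_sum:
  assumes "finite A"
  shows "coeff (\<Sum>\<sigma>\<in>A. (if f \<sigma> = a then 1 else 0) * [:0, 1:] ^ d \<sigma>) b
    = (of_nat (card {\<sigma>\<in>A. f \<sigma> = a \<and> d \<sigma> = b}) :: nat)"
proof -
  have X: "[:0, 1:] ^ i = (monom 1 i :: nat poly)" for i by (simp add: monom_altdef del: One_nat_def)
  have "coeff ((if f \<sigma> = a then 1 else 0) * [:0, 1:] ^ d \<sigma>) b
      = (if f \<sigma> = a \<and> d \<sigma> = b then 1 else 0 :: nat)" for \<sigma>
    by (simp add: X del: One_nat_def)
  then show ?thesis using assms by (simp add: coeff_sum sum.inter_filter[symmetric])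
qed

theorem theorem1p4:
  fixes g l h :: nat and t q :: "'a :: comm_semiring_1"
  assumes "g \<ge> 1" and "l \<ge> 1" and "1 \<le> h" and "h \<le> g + l"
  shows "Euler_Mahonian (g + l - 1) (exc g l) (den g h) \<and>
    (\<forall>n\<ge>1. (\<Sum>\<sigma>\<in>sym_grp n. t ^ exc g l n \<sigma> * q ^ den g h n \<sigma>)
          = (\<Sum>\<sigma>\<in>sym_grp n. t ^ rdes (g + l - 1) n \<sigma> * q ^ rmaj (g + l - 1) n \<sigma>))"
proof (intro conjI allI impI)
  show "Euler_Mahonian (g + l - 1) (exc g l) (den g h)"
    unfolding Euler_Mahonian_def
  proof (intro allI impI)
    fix n a b :: nat
    note equidistribution[OF assms(1,2,4), where n = n
        and w = "\<lambda>k. if k = a then 1 else 0" and q = "[:0, 1:] :: nat poly"]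
    from arg_cong[where f = "\<lambda>p. coeff p b", OF this]
    show "card {\<sigma> \<in> sym_grp n. exc g l n \<sigma> = a \<and> den g h n \<sigma> = b}
        = card {\<sigma> \<in> sym_grp n. rdes (g + l - 1) n \<sigma> = a \<and> rmaj (g + l - 1) n \<sigma> = b}"
      unfolding coeff_indicator_sum[OF finite_sym_grp] by simp
  qed
  show "(\<Sum>\<sigma>\<in>sym_grp n. t ^ exc g l n \<sigma> * q ^ den g h n \<sigma>)
      = (\<Sum>\<sigma>\<in>sym_grp n. t ^ rdes (g + l - 1) n \<sigma> * q ^ rmaj (g + l - 1) n \<sigma>)" for n
    by (rule equidistribution[OF assms(1,2,4)])
qed

end
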